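(* Let $d\ge2$ and assume that the radius is constant, $R_1\equiv c$ almost surely with $0<c<1$. Then, as $n\to\infty$: 1. if balls are taken with respect to the $\ell_1$-norm, $$\mathbb{P}[K\ge n]=\exp\Big(-\Big(1+\frac1{d-1}\Big)n\log n\cdot(1+o(1))\Big);$$ 2. if balls are taken with respect to the $\ell_2$-norm, $$\exp\Big(-\Big(1+\frac2{d-1}\Big)n\log n\cdot(1+o(1))\Big)\le\mathbb{P}[K\ge n]\le\exp\Big(-\Big(1+\frac1{d-1}\Big)n\log n\cdot(1+o(1))\Big);$$ 3. if balls are taken with respect to the $\ell_\infty$-norm, $$\exp\Big(-\Big(1+\frac1{d-1}\Big)n\log n\cdot(1+o(1))\Big)\le\mathbb{P}[K\ge n].$$
   Context: Setting: fix a norm $\|\cdot\|$ on $\mathbb{R}^d$ and let $B(x,r)$ be the closed ball of centre $x$ and radius $r$ in this norm. Let $(\xi_i)_{i\ge1}$ be i.i.d. uniform on $[0,1]^d$, $(R_i)_{i\ge1}$ i.i.d. positive random variables, $N$ a Poisson random variable with parameter $\lambda>0$; the families $(\xi_i)$, $(R_i)$ and $N$ are independent. Define the random set $S:=\bigcup_{i=1}^N B(\xi_i,R_i)\cap[0,1]^d$ and $$K:=\min\Big\{r\ge1 \;\Big|\; \exists\, i_1,\dots,i_r\in\{1,\dots,N\}:\ S=\bigcup_{s=1}^r B(\xi_{i_s},R_{i_s})\cap[0,1]^d\Big\},$$ with $K:=0$ if $N=0$. Notation: a relation $f(n)=\exp(-a\,n\log n\cdot(1+o(1)))$ (resp. $\le$,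 $\ge$) means there is a sequence $\varepsilon_n\to0$ with $f(n)=\exp(-a\,n\log n\,(1+\varepsilon_n))$ (resp. $\le$, $\ge$) for all large $n$. *)

theory Defs
  imports "HOL-Probability.Probability"
begin

definition l1_norm :: "real ^ 'n \<Rightarrow> real" where
  "l1_norm x = (\<Sum>i\<in>UNIV. \<bar>x $ i\<bar>)"

text \<open>In \<open>real ^ 'n\<close>, \<open>1\<close> is the all-ones vector, so this is \<open>[0,1]^d\<close>.\<close>

abbreviation unit_cube :: "(real ^ 'n) set" where
  "unit_cube \<equiv> cbox 0 1"

definition norm_ball :: "(real ^ 'n \<Rightarrow> real) \<Rightarrow> real ^ 'n \<Rightarrow> real \<Rightarrow> (real ^ 'n) set" where
  "norm_ball nrm x r = {y. nrm (y - x) \<le> r}"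

text \<open>Here \<open>x\<close>, \<open>r\<close>, \<open>m\<close> are realisations of the centres, the radii and the number of balls;
  indices start at 1.\<close>

definition covered_set ::
  "(real ^ 'n \<Rightarrow> real) \<Rightarrow> (nat \<Rightarrow> real ^ 'n) \<Rightarrow> (nat \<Rightarrow> real) \<Rightarrow> nat \<Rightarrow> (real ^ 'n) set" where
  "covered_set nrm x r m = (\<Union>i\<in>{1..m}. norm_ball nrm (x i) (r i) \<inter> unit_cube)"

definition cover_number ::
  "(real ^ 'n \<Rightarrow> real) \<Rightarrow> (nat \<Rightarrow> real ^ 'n) \<Rightarrow> (nat \<Rightarrow> real) \<Rightarrow> nat \<Rightarrow> nat" where
  "cover_number nrm x r m =
     (if m = 0 then 0
      else (LEAST k. k \<ge> 1 \<and> (\<exists>i :: nat \<Rightarrow> nat. (\<forall>s\<in>{1..k}. i s \<in> {1..m}) \<and>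
              covered_set nrm x r m =
                (\<Union>s\<in>{1..k}. norm_ball nrm (x (i s)) (r (i s)) \<inter> unit_cube))))"

datatype family = Centres | Radii | Number

text \<open>The centres, the radii and the number of balls take values in different types, so the
  independence of the three families is stated through the sigma-algebras they generate.\<close>

locale poisson_balls = prob_space M for M :: "'a measure" +
  fixes \<xi> :: "nat \<Rightarrow> 'a \<Rightarrow> real ^ 'n"
    and R :: "nat \<Rightarrow> 'a \<Rightarrow> real"
    and N :: "'a \<Rightarrow> nat"
    and rate :: real
  assumes rate_pos: "rate > 0"
    and centres_indep: "indep_vars (\<lambda>_. borel) \<xi> {1..}"
    and centres_uniform:
      "\<And>i. i \<ge> 1 \<Longrightarrow> distr M borel (\<xi> i) = uniform_measure lborel unit_cube"
    and radii_indep: "indep_vars (\<lambda>_. borel) R {1..}"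
    and radii_ident: "\<And>i. i \<ge> 1 \<Longrightarrow> distr M borel (R i) = distr M borel (R 1)"
    and radii_pos: "\<And>i. i \<ge> 1 \<Longrightarrow> AE \<omega> in M. R i \<omega> > 0"
    and number_measurable: "N \<in> M \<rightarrow>\<^sub>M count_space UNIV"
    and number_poisson: "distr M (count_space UNIV) N = measure_pmf (poisson_pmf rate)"
    and families_indep:
      "indep_sets (\<lambda>f. case f of
           Centres \<Rightarrow> sets (vimage_algebra (space M) (\<lambda>\<omega>. \<lambda>i\<in>{1..}. \<xi> i \<omega>) (PiM {1..} (\<lambda>_. borel)))
         | Radii \<Rightarrow> sets (vimage_algebra (space M) (\<lambda>\<omega>. \<lambda>i\<in>{1..}. R i \<omega>) (PiM {1..} (\<lambda>_. borel)))
         | Number \<Rightarrow> sets (vimage_algebra (space M) N (count_space UNIV)))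
       UNIV"

definition cover_prob ::
  "'a measure \<Rightarrow> (real ^ 'n \<Rightarrow> real) \<Rightarrow> (nat \<Rightarrow> 'a \<Rightarrow> real ^ 'n) \<Rightarrow> (nat \<Rightarrow> 'a \<Rightarrow> real) \<Rightarrow> ('a \<Rightarrow> nat)
     \<Rightarrow> nat \<Rightarrow> real" where
  "cover_prob M nrm \<xi> R N n =
     measure M {\<omega> \<in> space M. cover_number nrm (\<lambda>i. \<xi> i \<omega>) (\<lambda>i. R i \<omega>) (N \<omega>) \<ge> n}"

text \<open>\<open>f n = exp (- a n log n (1 + o(1)))\<close>, and likewise with \<open>\<le>\<close> and \<open>\<ge>\<close>.\<close>

definition nlogn_eq :: "(nat \<Rightarrow> real) \<Rightarrow> real \<Rightarrow> bool" where
  "nlogn_eq f a \<longleftrightarrow> (\<exists>\<epsilon> :: nat \<Rightarrow> real. \<epsilon> \<longlonglongrightarrow> 0 \<and>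
     (\<forall>\<^sub>F n in sequentially. f n = exp (- a * real n * ln (real n) * (1 + \<epsilon> n))))"

definition nlogn_le :: "(nat \<Rightarrow> real) \<Rightarrow> real \<Rightarrow> bool" where
  "nlogn_le f a \<longleftrightarrow> (\<exists>\<epsilon> :: nat \<Rightarrow> real. \<epsilon> \<longlonglongrightarrow> 0 \<and>
     (\<forall>\<^sub>F n in sequentially. f n \<le> exp (- a * real n * ln (real n) * (1 + \<epsilon> n))))"

definition nlogn_ge :: "(nat \<Rightarrow> real) \<Rightarrow> real \<Rightarrow> bool" where
  "nlogn_ge f a \<longleftrightarrow> (\<exists>\<epsilon> :: nat \<Rightarrow> real. \<epsilon> \<longlonglongrightarrow> 0 \<and>
     (\<forall>\<^sub>F n in sequentially. f n \<ge> exp (- a * real n * ln (real n) * (1 + \<epsilon> n))))"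

end

theory Submission
  imports Defs "HOL-Real_Asymp.Real_Asymp"
begin

text \<open>
  A family of balls is called irredundant if each of its balls has a witness, a point of the cube
  that lies in this ball and in no other ball of the family. A minimal subcover of \<open>S\<close> is
  irredundant, and conversely \<open>n\<close> balls that are irredundant need all \<open>n\<close> of them. So the event
  \<open>K \<ge> n\<close> is governed by the probability \<open>p\<^sub>n\<close> that \<open>n\<close> independent uniform centres give an
  irredundant family: with \<open>d\<close> the dimension, the expected number of irredundant subfamilies
  of size \<open>n\<close> is \<open>rate\<^sup>n / n! * p\<^sub>n\<close>, which
  bounds the probability from above, and the event \<open>N = n\<close> alone contributes
  \<open>exp (- rate) * rate\<^sup>n / n! * p\<^sub>n\<close> from below (\<open>cover_prob_le\<close>, \<open>cover_prob_ge\<close>). The factor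
  \<open>1 / n!\<close> accounts for the summand \<open>1\<close> in the exponents; the other summand comes from \<open>p\<^sub>n\<close>.

  Upper bound. For the \<open>\<ell>\<^sub>1\<close>- and the \<open>\<ell>\<^sub>2\<close>-norm, every vector \<open>w\<close> of norm at most \<open>c\<close> has a
  coordinate direction \<open>\<plusminus>e\<^sub>k\<close> along which moving by \<open>t\<close> brings the norm below \<open>c\<close> by a
  margin linear in \<open>t\<close> (\<open>axis_descent\<close>). Take two centres of an irredundant family whose
  witnesses allow the same direction, and suppose that they agree up to \<open>1/m\<close> in all coordinates
  but the \<open>k\<close>-th. If their
  \<open>k\<close>-th coordinates differed by much more than \<open>1/m\<close>, one of the two balls would swallow the
  witness of the other. So the centres behave like points on boundedly many Lipschitz graphs over
  coordinate hyperplanes: they occupy \<open>O(m\<^bsup>d-1\<^esup>)\<close> of the \<open>m\<^sup>d\<close> grid cells of side \<open>1/m\<close>. Counting the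
  possible assignments of centres to grid cells (\<open>card_cell_assignments_le\<close>,
  \<open>irredundant_cell_assignment\<close>) gives a bound of the form
  \<open>p\<^sub>n \<le> const\<^sup>n * m\<^bsup>-n\<^esup> * exp (O(m\<^bsup>d-1\<^esup> * ln m))\<close>, and with \<open>m\<^bsup>d-1\<^esup>\<close> of order \<open>n / ln n\<close> this is
  \<open>exp (- n ln n / (d - 1) * (1 + o(1)))\<close>. For the \<open>\<ell>\<^sub>\<infinity>\<close>-norm there is no such direction when \<open>w\<close>
  is a corner of the ball.

  Lower bound. Put \<open>n\<close> reference centres in a grid of spacing about \<open>n\<^bsup>-1/(d-1)\<^esup>\<close> on a hyperplane,
  with the witnesses in front of them at distance about \<open>c\<close>. The distance from a witness to the
  other reference centres exceeds \<open>c\<close> by the order of the spacing if the ball has a corner at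
  the witness (\<open>\<ell>\<^sub>1\<close>, and \<open>\<ell>\<^sub>\<infinity>\<close> for a hyperplane perpendicular to a diagonal of the cube), but only
  by the order of the squared spacing if the ball is round (\<open>\<ell>\<^sub>2\<close>). Each centre may therefore move
  in a box of volume \<open>const * n\<^bsup>-d/(d-1)\<^esup>\<close>, respectively \<open>const * n\<^bsup>-(d+1)/(d-1)\<^esup>\<close>, and the \<open>n!\<close>
  ways of distributing the centres over the boxes cancel the factor \<open>1 / n!\<close>.
\<close>

section \<open>Irredundant families of balls\<close>

text \<open>
  Points outside the cube do not matter, hence the witness is taken from the cube.
\<close>

definition uncovered ::
  "(real ^ 'n \<Rightarrow> real) \<Rightarrow> (nat \<Rightarrow> real ^ 'n) \<Rightarrow> (nat \<Rightarrow> real) \<Rightarrow> nat \<Rightarrow> nat set \<Rightarrow> bool" where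
  "uncovered nrm x r l J \<longleftrightarrow>
     (\<exists>y\<in>unit_cube. nrm (y - x l) \<le> r l \<and> (\<forall>j\<in>J. r j < nrm (y - x j)))"

definition irredundant ::
  "(real ^ 'n \<Rightarrow> real) \<Rightarrow> (nat \<Rightarrow> real ^ 'n) \<Rightarrow> (nat \<Rightarrow> real) \<Rightarrow> nat set \<Rightarrow> bool" where
  "irredundant nrm x r I \<longleftrightarrow> (\<forall>i\<in>I. uncovered nrm x r i (I - {i}))"

lemma uncovered_antimono: "uncovered nrm x r l J \<Longrightarrow> J' \<subseteq> J \<Longrightarrow> uncovered nrm x r l J'"
  unfolding uncovered_def by blast

lemma irredundant_subset: "irredundant nrm x r I \<Longrightarrow> I' \<subseteq> I \<Longrightarrow> irredundant nrm x r I'"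
  unfolding irredundant_def by (meson Diff_mono order_refl subset_iff uncovered_antimono)

lemma covered_set_eq_iff:
  assumes "J \<subseteq> {1..m}"
  shows "covered_set nrm x r m = (\<Union>j\<in>J. norm_ball nrm (x j) (r j) \<inter> unit_cube)
    \<longleftrightarrow> (\<forall>l\<in>{1..m}. \<not> uncovered nrm x r l J)"
proof -
  have "(\<Union>j\<in>J. norm_ball nrm (x j) (r j) \<inter> unit_cube) \<subseteq> covered_set nrm x r m"
    using assms unfolding covered_set_def by blast
  moreover have "covered_set nrm x r m \<subseteq> (\<Union>j\<in>J. norm_ball nrm (x j) (r j) \<inter> unit_cube)
    \<longleftrightarrow> (\<forall>l\<in>{1..m}. \<not> uncovered nrm x r l J)"
    unfolding covered_set_def uncovered_def norm_ball_def
    by (auto simp: subset_iff not_less)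
  ultimately show ?thesis by blast
qed

text \<open>
  The minimum over index sequences, repetitions included, becomes a statement about index sets: a
  sequence of length \<open>k\<close> has an image of at most \<open>k\<close> elements, and a set of \<open>k\<close> elements is the
  image of a sequence of length \<open>k\<close>.
\<close>

lemma cover_number_ge_iff:
  assumes "n \<ge> 1"
  shows "n \<le> cover_number nrm x r m \<longleftrightarrow>
    m \<ge> 1 \<and> (\<forall>J\<subseteq>{1..m}. J \<noteq> {} \<and> card J < n \<longrightarrow> (\<exists>l\<in>{1..m}. uncovered nrm x r l J))"
proof (cases "m = 0")
  case True
  then show ?thesis using assms by (simp add: cover_number_def)
next
  case False
  define U where "U J = (\<Union>j\<in>J. norm_ball nrm (x j) (r j) \<inter> unit_cube)" for J
  define P where "P k \<longleftrightarrow> k \<ge> 1 \<and> (\<exists>i :: nat \<Rightarrow> nat. (\<forall>s\<in>{1..k}. i s \<in> {1..m}) \<and>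
              covered_set nrm x r m = U (i ` {1..k}))" for k
  have K: "cover_number nrm x r m = (LEAST k. P k)"
    using False by (simp add: cover_number_def P_def U_def)
  have "P m"
    using False unfolding P_def U_def covered_set_def by (auto intro!: exI[of _ id])
  then have "P (LEAST k. P k)" by (rule LeastI)
  then have "n \<le> (LEAST k. P k) \<longleftrightarrow> (\<forall>k<n. \<not> P k)"
    by (meson leI not_less_Least order_less_le_trans)
  also have "\<dots> \<longleftrightarrow> (\<forall>J\<subseteq>{1..m}. J \<noteq> {} \<and> card J < n \<longrightarrow> covered_set nrm x r m \<noteq> U J)"
  proof (intro iffI allI impI)
    fix J assume L: "\<forall>k<n. \<not> P k" and J: "J \<subseteq> {1..m}" "J \<noteq> {} \<and> card J < n"
    then have fin: "finite J" using finite_subset by blast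
    then obtain i where i: "bij_betw i {1..card J} J"
      using ex_bij_betw_nat_finite_1 by blast
    have "card J \<ge> 1" using J fin by (simp add: Suc_le_eq card_gt_0_iff)
    moreover have "i ` {1..card J} = J" using i by (simp add: bij_betw_def)
    ultimately show "covered_set nrm x r m \<noteq> U J"
      using L J unfolding P_def by (metis imageI subsetD)
  next
    fix k assume L: "\<forall>J\<subseteq>{1..m}. J \<noteq> {} \<and> card J < n \<longrightarrow> covered_set nrm x r m \<noteq> U J"
      and k: "k < n"
    show "\<not> P k"
    proof
      assume "P k"
      then obtain i where i: "k \<ge> 1" "\<forall>s\<in>{1..k}. i s \<in> {1..m}"
        "covered_set nrm x r m = U (i ` {1..k})" unfolding P_def by blast
      have "card (i ` {1..k}) < n"
        using card_image_le[of "{1..k}" i] k by simp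
      moreover have "i ` {1..k} \<subseteq> {1..m}" "i ` {1..k} \<noteq> {}" using i by auto
      ultimately show False using L[rule_format, of "i ` {1..k}"] i(3) by simp
    qed
  qed
  also have "\<dots> \<longleftrightarrow> (\<forall>J\<subseteq>{1..m}. J \<noteq> {} \<and> card J < n \<longrightarrow> (\<exists>l\<in>{1..m}. uncovered nrm x r l J))"
  proof -
    have "covered_set nrm x r m \<noteq> U J \<longleftrightarrow> (\<exists>l\<in>{1..m}. uncovered nrm x r l J)"
      if "J \<subseteq> {1..m}" for J
      using covered_set_eq_iff[OF that, of nrm x r] unfolding U_def by (simp only: bex_simps) blast
    then show ?thesis by (simp cong: conj_cong)
  qed
  finally show ?thesis using K False by simp
qed

text \<open>
  A nonempty subcover of least cardinality is irredundant: dropping a ball \<open>i\<close> leaves some point of \<open>S\<close>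
  uncovered, and as the subcover did cover this point, it was ball \<open>i\<close> that did. The restriction to
  \<open>n \<ge> 2\<close> keeps the subcover nonempty when a ball is dropped.
\<close>

lemma irredundant_of_cover_number_ge:
  assumes n: "n \<ge> 2" and K: "n \<le> cover_number nrm x r m"
  shows "\<exists>I\<subseteq>{1..m}. card I = n \<and> irredundant nrm x r I"
proof -
  define C where "C J \<longleftrightarrow> J \<subseteq> {1..m} \<and> J \<noteq> {} \<and> (\<forall>l\<in>{1..m}. \<not> uncovered nrm x r l J)" for J
  have m: "m \<ge> 1"
    and bound: "J \<subseteq> {1..m} \<Longrightarrow> J \<noteq> {} \<Longrightarrow> card J < n \<Longrightarrow> (\<exists>l\<in>{1..m}. uncovered nrm x r l J)" for J
    using K n cover_number_ge_iff[of n nrm x r m] by auto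
  have "C {1..m}" using m unfolding C_def uncovered_def by (auto simp: not_less)
  then obtain J where J: "C J" and least: "\<And>J'. C J' \<Longrightarrow> card J \<le> card J'"
    using ex_has_least_nat[of C "{1..m}" card] by blast
  have fin: "finite J" using J finite_subset unfolding C_def by blast
  have "card J \<ge> n" using bound[of J] J unfolding C_def by (meson leI)
  have "irredundant nrm x r J"
    unfolding irredundant_def
  proof
    fix i assume i: "i \<in> J"
    have cardm: "card (J - {i}) < card J" using card_Diff1_less[OF fin i] .
    then have "\<not> C (J - {i})" using least by (meson leD)
    moreover have "J - {i} \<noteq> {}"
    proof
      assume "J - {i} = {}"
      then have "card J - 1 = 0" using card_Diff_singleton[OF i] by (metis card.empty)
      then show False using \<open>card J \<ge> n\<close> n by simp
    qed
    ultimately obtain l where l: "l \<in> {1..m}" "uncovered nrm x r l (J - {i})"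
      using J unfolding C_def by blast
    then obtain y where y: "y \<in> unit_cube" "nrm (y - x l) \<le> r l" "\<forall>j\<in>J - {i}. r j < nrm (y - x j)"
      unfolding uncovered_def by blast
    have "\<not> uncovered nrm x r l J" using J l unfolding C_def by blast
    then obtain j where "j \<in> J" "nrm (y - x j) \<le> r j"
      using y unfolding uncovered_def by (metis leI)
    then have "nrm (y - x i) \<le> r i" using y(3) by (metis DiffI leD singletonD)
    then show "uncovered nrm x r i (J - {i})" using y unfolding uncovered_def by blast
  qed
  moreover obtain I where "I \<subseteq> J" "card I = n"
    using \<open>card J \<ge> n\<close> fin by (meson obtain_subset_with_card_n)
  ultimately show ?thesis
    using J irredundant_subset[of nrm x r J I] unfolding C_def by (intro exI[of _ I]) auto
qed

text \<open>
  A subfamily of fewer than \<open>n\<close> balls misses some ball and hence its witness.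
\<close>

lemma cover_number_ge_of_irredundant:
  assumes n: "n \<ge> 1" and I: "irredundant nrm x r {1..n}"
  shows "n \<le> cover_number nrm x r n"
proof -
  have "\<exists>l\<in>{1..n}. uncovered nrm x r l J" if J: "J \<subseteq> {1..n}" "card J < n" for J
  proof -
    have "J \<noteq> {1..n}" using J by auto
    then obtain l where "l \<in> {1..n}" "l \<notin> J" using J by blast
    moreover have "J \<subseteq> {1..n} - {l}" using J \<open>l \<notin> J\<close> by blast
    ultimately show ?thesis
      using I uncovered_antimono[of nrm x r l "{1..n} - {l}" J] unfolding irredundant_def by blast
  qed
  then show ?thesis using n by (simp add: cover_number_ge_iff)
qed

text \<open>
  The existence of a witness is a projection along the cube. Writing the strict inequalities with a
  margin \<open>1 / (k + 1)\<close> makes the conditions on the witness closed; as the cube is compact, they can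
  then be relaxed by an arbitrarily small \<open>1 / (e + 1)\<close> and tested on a countable dense set. In this form
  the event is visibly measurable.
\<close>

lemma uncovered_countable:
  fixes nrm :: "real ^ 'n \<Rightarrow> real"
  assumes cont: "continuous_on UNIV nrm" and "finite J"
    and D: "D \<subseteq> unit_cube" "unit_cube \<subseteq> closure D"
  shows "uncovered nrm x r l J \<longleftrightarrow> (\<exists>k::nat. \<forall>e::nat. \<exists>y\<in>D.
    nrm (y - x l) < r l + 1 / Suc e \<and> (\<forall>j\<in>J. r j + 1 / Suc k < nrm (y - x j) + 1 / Suc e))"
    (is "?L \<longleftrightarrow> ?R")
proof
  assume ?L
  then obtain y where y: "y \<in> unit_cube" "nrm (y - x l) \<le> r l" "\<forall>j\<in>J. r j < nrm (y - x j)"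
    unfolding uncovered_def by blast
  have "\<exists>k::nat. \<forall>j\<in>J. r j + 1 / Suc k \<le> nrm (y - x j)"
    using \<open>finite J\<close> y(3)
  proof (induction J)
    case (insert a F)
    then obtain k where k: "\<forall>j\<in>F. r j + 1 / Suc k \<le> nrm (y - x j)" by auto
    have "0 < nrm (y - x a) - r a" using insert by auto
    then obtain k' :: nat where k': "1 / Suc k' < nrm (y - x a) - r a"
      using nat_approx_posE by blast
    have "1 / Suc (max k k') \<le> 1 / Suc k" "1 / Suc (max k k') \<le> 1 / Suc k'"
      by (auto simp: field_simps)
    then show ?case using k k' 
      by (intro exI[of _ "max k k'"] ballI) (force simp del: of_nat_Suc)
  qed auto
  then obtain k :: nat where k: "\<forall>j\<in>J. r j + 1 / Suc k \<le> nrm (y - x j)" by blast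
  have "\<exists>y\<in>D. nrm (y - x l) < r l + 1 / Suc e \<and> (\<forall>j\<in>J. r j + 1 / Suc k < nrm (y - x j) + 1 / Suc e)"
    for e :: nat
  proof -
    define W where "W = {y. nrm (y - x l) < r l + 1 / Suc e} \<inter>
      (\<Inter>j\<in>J. {y. r j + 1 / Suc k < nrm (y - x j) + 1 / Suc e})"
    have [continuous_intros]: "continuous_on UNIV (\<lambda>y. nrm (y - a))" for a
      using continuous_on_compose2[OF cont, of UNIV "\<lambda>y. y - a"] by (simp add: continuous_on_diff)
    have "open W" unfolding W_def using \<open>finite J\<close>
      by (intro open_Int open_INT ballI open_Collect_less continuous_intros) auto
    moreover have "y \<in> W" using y(2) k unfolding W_def
      by (auto intro: order_le_less_trans)
    moreover have "y \<in> closure D" using y D by blast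
    ultimately obtain y' where "y' \<in> D" "y' \<in> W"
      using open_Int_closure_eq_empty[of W D] by blast
    then show ?thesis unfolding W_def by blast
  qed
  then show ?R by blast
next
  assume ?R
  then obtain k :: nat and Y where Y: "\<And>e::nat. Y e \<in> D"
    "\<And>e. nrm (Y e - x l) < r l + 1 / Suc e"
    "\<And>e j. j \<in> J \<Longrightarrow> r j + 1 / Suc k < nrm (Y e - x j) + 1 / Suc e"
    by metis
  obtain y s where ys: "y \<in> unit_cube" "strict_mono (s :: nat \<Rightarrow> nat)" "(Y \<circ> s) \<longlonglongrightarrow> y"
    using compact_cbox[of 0 "1 :: real ^ 'n"] Y(1) D(1) unfolding compact_def by (metis subsetD)
  have lim: "(\<lambda>e. nrm (Y (s e) - a)) \<longlonglongrightarrow> nrm (y - a)" for a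
  proof -
    have "isCont nrm (y - a)" using cont by (simp add: continuous_on_eq_continuous_at)
    moreover have "(\<lambda>e. Y (s e) - a) \<longlonglongrightarrow> y - a"
      using ys(3) by (intro tendsto_intros) (simp add: o_def)
    ultimately show ?thesis by (rule isCont_tendsto_compose)
  qed
  have inv: "(\<lambda>e. 1 / real (Suc (s e))) \<longlonglongrightarrow> 0"
    using LIMSEQ_subseq_LIMSEQ[OF lim_1_over_n[THEN LIMSEQ_Suc] ys(2)] by (simp add: o_def)
  have "nrm (y - x l) \<le> r l + 0"
    using Y(2) by (intro LIMSEQ_le[OF lim tendsto_add[OF tendsto_const inv]]) (auto intro: less_imp_le)
  moreover have "r j < nrm (y - x j)" if "j \<in> J" for j
  proof -
    have "r j + 1 / Suc k \<le> nrm (y - x j) + 0"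
      using Y(3)[OF that]
      by (intro LIMSEQ_le[OF tendsto_const tendsto_add[OF lim inv]]) (auto intro: less_imp_le)
    moreover have "1 / real (Suc k) > 0" by simp
    ultimately show ?thesis by linarith
  qed
  ultimately show ?L using ys(1) unfolding uncovered_def by auto
qed

lemma pred_countable_bex:
  "countable D \<Longrightarrow> (\<And>y. y \<in> D \<Longrightarrow> Measurable.pred M (P y)) \<Longrightarrow> Measurable.pred M (\<lambda>\<omega>. \<exists>y\<in>D. P y \<omega>)"
  unfolding pred_def by (rule sets.sets_Collect_countable_Ex')

lemma measurable_uncovered:
  fixes nrm :: "real ^ 'n \<Rightarrow> real"
  assumes cont: "continuous_on UNIV nrm" and J: "finite J"
    and X: "\<And>i. i \<in> insert l J \<Longrightarrow> X i \<in> borel_measurable M"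
    and R: "\<And>i. i \<in> insert l J \<Longrightarrow> R i \<in> borel_measurable M"
  shows "Measurable.pred M (\<lambda>\<omega>. uncovered nrm (\<lambda>i. X i \<omega>) (\<lambda>i. R i \<omega>) l J)"
proof -
  obtain D where D: "countable D" "D \<subseteq> unit_cube" "unit_cube \<subseteq> closure (D :: (real ^ 'n) set)"
    using separable by blast
  have nb: "nrm \<in> borel_measurable borel"
    using cont by (rule borel_measurable_continuous_onI)
  have [measurable]: "(\<lambda>\<omega>. nrm (y - X i \<omega>)) \<in> borel_measurable M"
     "R i \<in> borel_measurable M" if "i \<in> insert l J" for y i
    using X[OF that] R[OF that] nb by measurable
  show ?thesis
    unfolding uncovered_countable[OF cont J D(2,3)]
    using J D(1)
    by (intro pred_intros_countable(1,2)[where 'i = nat] pred_countable_bex pred_intros_logic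
       pred_intros_finite(3)) (auto intro!: borel_measurable_less borel_measurable_add simp del: of_nat_Suc)
qed

text \<open>
  A null set of exceptional realisations, with centres outside the cube or negative radii, cannot be
  discarded here, because \<open>measure\<close> is monotone only towards measurable sets and a set that is
  measurable up to a null set need not be measurable.
\<close>

lemma measurable_cover_number_ge:
  fixes nrm :: "real ^ 'n \<Rightarrow> real"
  assumes cont: "continuous_on UNIV nrm"
    and X: "\<And>i. i \<ge> 1 \<Longrightarrow> X i \<in> borel_measurable M"
    and R: "\<And>i. i \<ge> 1 \<Longrightarrow> R i \<in> borel_measurable M"
    and N: "N \<in> M \<rightarrow>\<^sub>M count_space UNIV"
  shows "{\<omega> \<in> space M. n \<le> cover_number nrm (\<lambda>i. X i \<omega>) (\<lambda>i. R i \<omega>) (N \<omega>)} \<in> sets M"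
proof (cases "n = 0")
  case False
  then have n: "n \<ge> 1" by simp
  have "Measurable.pred M (\<lambda>\<omega>. n \<le> cover_number nrm (\<lambda>i. X i \<omega>) (\<lambda>i. R i \<omega>) m)" for m
  proof -
    have "Measurable.pred M (\<lambda>\<omega>. m \<ge> 1 \<and> (\<forall>J\<in>Pow {1..m}. J \<noteq> {} \<and> card J < n \<longrightarrow>
       (\<exists>l\<in>{1..m}. uncovered nrm (\<lambda>i. X i \<omega>) (\<lambda>i. R i \<omega>) l J)))"
    proof (intro pred_intros_finite(3,4) pred_intros_conj1' pred_intros_imp' measurable_uncovered cont)
      show "finite J" if "J \<in> Pow {1..m}" for J
        using that finite_subset by blast
    qed (use X R in \<open>auto simp: subset_iff\<close>)
    then show ?thesis unfolding cover_number_ge_iff[OF n] by (simp only: Ball_def Pow_iff)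
  qed
  note [measurable] = this N
  have "Measurable.pred M (\<lambda>\<omega>. \<exists>m. N \<omega> = m \<and> n \<le> cover_number nrm (\<lambda>i. X i \<omega>) (\<lambda>i. R i \<omega>) m)"
    by measurable
  then show ?thesis by (simp add: pred_def)
qed simp

section \<open>From geometry to probability\<close>

context poisson_balls
begin

lemma measurable_centre: "i \<ge> 1 \<Longrightarrow> \<xi> i \<in> borel_measurable M"
  using centres_indep unfolding indep_vars_def by auto

lemma measurable_radius: "i \<ge> 1 \<Longrightarrow> R i \<in> borel_measurable M"
  using radii_indep unfolding indep_vars_def by auto

lemma prob_centre_in:
  assumes i: "i \<ge> 1" and A: "A \<in> sets borel"
  shows "prob (\<xi> i -` A \<inter> space M) = measure lborel (unit_cube \<inter> A)"
proof -
  have "measure lborel (unit_cube :: (real ^ 'n) set) = 1"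
    by (simp add: content_cbox_cart interval_ne_empty_cart)
  moreover have "emeasure lborel (unit_cube :: (real ^ 'n) set) \<noteq> 0"
    using calculation by (auto simp: measure_def)
  moreover have "emeasure lborel (unit_cube :: (real ^ 'n) set) \<noteq> \<infinity>"
    using emeasure_lborel_cbox_finite[of 0 "1 :: real ^ 'n"] by auto
  moreover have "prob (\<xi> i -` A \<inter> space M) = measure (uniform_measure lborel unit_cube) A"
    using measure_distr[OF measurable_centre[OF i] A] centres_uniform[OF i] by simp
  ultimately show ?thesis
    using A by (simp add: measure_uniform_measure)
qed

lemma AE_centres_in_cube: "AE \<omega> in M. \<forall>i\<ge>1. \<xi> i \<omega> \<in> unit_cube"
proof -
  have "AE \<omega> in M. \<xi> i \<omega> \<in> unit_cube" if i: "i \<ge> 1" for i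
  proof -
    have "AE x in uniform_measure lborel (unit_cube :: (real ^ 'n) set). x \<in> unit_cube"
      by (rule AE_uniform_measureI) auto
    then have "AE x in distr M borel (\<xi> i). x \<in> unit_cube"
      by (subst centres_uniform[OF i])
    then show ?thesis using measurable_centre[OF i] by (subst (asm) AE_distr_iff) auto
  qed
  then show ?thesis by (simp add: AE_all_countable)
qed

lemma AE_radii_eq:
  assumes "AE \<omega> in M. R 1 \<omega> = c"
  shows "AE \<omega> in M. \<forall>i\<ge>1. R i \<omega> = c"
proof -
  have "AE \<omega> in M. R i \<omega> = c" if i: "i \<ge> 1" for i
  proof -
    have "AE x in distr M borel (R 1). x = c"
      using assms measurable_radius[of 1] by (subst AE_distr_iff) auto
    then have "AE x in distr M borel (R i). x = c"
      by (subst radii_ident[OF i])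
    then show ?thesis using measurable_radius[OF i] by (subst (asm) AE_distr_iff) auto
  qed
  then show ?thesis by (simp add: AE_all_countable)
qed

text \<open>
  The event about the centres is the preimage of a cylinder set under the whole sequence of centres,
  so it belongs to the sigma-algebra for which independence from \<open>N\<close> is known.
\<close>

lemma prob_number_centres:
  assumes I: "finite I" "I \<subseteq> {1..}" and A: "\<And>i. i \<in> I \<Longrightarrow> A i \<in> sets borel"
  shows "{\<omega> \<in> space M. N \<omega> = m \<and> (\<forall>i\<in>I. \<xi> i \<omega> \<in> A i)} \<in> events"
    and "prob {\<omega> \<in> space M. N \<omega> = m \<and> (\<forall>i\<in>I. \<xi> i \<omega> \<in> A i)}
      = pmf (poisson_pmf rate) m * (\<Prod>i\<in>I. measure lborel (unit_cube \<inter> A i))"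
proof -
  note [measurable] = number_measurable
  have [measurable]: "Measurable.pred M (\<lambda>\<omega>. \<forall>i\<in>I. \<xi> i \<omega> \<in> A i)"
    using I A by (intro pred_intros_finite(3) pred_sets1[OF _ measurable_centre]) auto
  show "{\<omega> \<in> space M. N \<omega> = m \<and> (\<forall>i\<in>I. \<xi> i \<omega> \<in> A i)} \<in> events"
    by measurable
  define EC where "EC = {\<omega> \<in> space M. \<forall>i\<in>I. \<xi> i \<omega> \<in> A i}"
  define EN where "EN = {\<omega> \<in> space M. N \<omega> = m}"
  define X where "X \<omega> = (\<lambda>i\<in>{1..}. \<xi> i \<omega>)" for \<omega>
  define F where "F f = (case f of
           Centres \<Rightarrow> sets (vimage_algebra (space M) (\<lambda>\<omega>. \<lambda>i\<in>{1..}. \<xi> i \<omega>) (PiM {1..} (\<lambda>_. borel)))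
         | Radii \<Rightarrow> sets (vimage_algebra (space M) (\<lambda>\<omega>. \<lambda>i\<in>{1..}. R i \<omega>) (PiM {1..} (\<lambda>_. borel)))
         | Number \<Rightarrow> sets (vimage_algebra (space M) N (count_space UNIV)))" for f
  have ind: "indep_sets F UNIV"
    using families_indep unfolding F_def .
  have "EC = X -` {f \<in> space (PiM {1..} (\<lambda>_. borel)). \<forall>i\<in>I. f i \<in> A i} \<inter> space M"
    using I unfolding EC_def X_def by (auto simp: space_PiM)
  moreover have "{f \<in> space (PiM {1..} (\<lambda>_. borel :: (real ^ 'n) measure)). \<forall>i\<in>I. f i \<in> A i}
      \<in> sets (PiM {1..} (\<lambda>_. borel))"
  proof -
    have "Measurable.pred (PiM {1..} (\<lambda>_. borel :: (real ^ 'n) measure)) (\<lambda>f. f i \<in> A i)"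
      if i: "i \<in> I" for i
      using i I A by (intro pred_sets1[OF _ measurable_component_singleton]) auto
    then show ?thesis using I unfolding pred_def[symmetric] by (intro pred_intros_finite(3))
  qed
  ultimately have "EC \<in> sets (vimage_algebra (space M) X (PiM {1..} (\<lambda>_. borel)))"
    by (simp only: in_vimage_algebra)
  then have "EC \<in> F Centres"
    unfolding F_def X_def by (simp only: family.case)
  moreover have "EN \<in> F Number"
  proof -
    have "EN = N -` {m} \<inter> space M" unfolding EN_def by auto
    then show ?thesis unfolding F_def by (auto intro: in_vimage_algebra)
  qed
  ultimately have "prob (\<Inter>f\<in>{Centres, Number}. case f of Centres \<Rightarrow> EC | _ \<Rightarrow> EN)
     = (\<Prod>f\<in>{Centres, Number}. prob (case f of Centres \<Rightarrow> EC | _ \<Rightarrow> EN))"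
    by (intro indep_setsD[OF ind]) auto
  then have 1: "prob (EC \<inter> EN) = prob EC * prob EN" by simp
  have 2: "prob EN = pmf (poisson_pmf rate) m"
  proof -
    have "prob EN = measure (distr M (count_space UNIV) N) {m}"
      using number_measurable by (subst measure_distr) (auto simp: EN_def intro!: arg_cong[where f = prob])
    then show ?thesis by (simp add: number_poisson measure_pmf_single)
  qed
  have 3: "prob EC = (\<Prod>i\<in>I. measure lborel (unit_cube \<inter> A i))"
  proof (cases "I = {}")
    case True
    then show ?thesis by (simp add: EC_def prob_space)
  next
    case False
    have "EC = (\<Inter>i\<in>I. \<xi> i -` A i \<inter> space M)"
      using False unfolding EC_def by auto
    then have "prob EC = (\<Prod>i\<in>I. prob (\<xi> i -` A i \<inter> space M))"
      using False I A indep_varsD[OF centres_indep, of I A] by simp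
    also have "\<dots> = (\<Prod>i\<in>I. measure lborel (unit_cube \<inter> A i))"
      using I A by (intro prod.cong prob_centre_in) auto
    finally show ?thesis .
  qed
  have "{\<omega> \<in> space M. N \<omega> = m \<and> (\<forall>i\<in>I. \<xi> i \<omega> \<in> A i)} = EC \<inter> EN"
    unfolding EC_def EN_def by auto
  then show "prob {\<omega> \<in> space M. N \<omega> = m \<and> (\<forall>i\<in>I. \<xi> i \<omega> \<in> A i)}
      = pmf (poisson_pmf rate) m * (\<Prod>i\<in>I. measure lborel (unit_cube \<inter> A i))"
    using 1 2 3 by simp
qed

text \<open>
  The binomial moments of the Poisson distribution: the expected number of \<open>n\<close>-element subsets of
  the \<open>N\<close> balls.
\<close>

lemma poisson_binomial_moment:
  "(\<lambda>m. pmf (poisson_pmf rate) m * real (m choose n)) sums (rate ^ n / fact n)"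
proof -
  have "(\<lambda>m. rate ^ n / fact n * exp (- rate) * (rate ^ m /\<^sub>R fact m))
     sums (rate ^ n / fact n * exp (- rate) * exp rate)"
    by (intro sums_mult exp_converges)
  then have "(\<lambda>m. rate ^ n / fact n * exp (- rate) * (rate ^ m /\<^sub>R fact m)) sums (rate ^ n / fact n)"
    by (simp add: exp_minus field_simps)
  moreover have "rate ^ n / fact n * exp (- rate) * (rate ^ m /\<^sub>R fact m)
    = pmf (poisson_pmf rate) (m + n) * real ((m + n) choose n)" for m
    using rate_pos by (simp add: binomial_fact power_add field_simps)
  ultimately have "(\<lambda>m. pmf (poisson_pmf rate) (m + n) * real ((m + n) choose n)) sums (rate ^ n / fact n)"
    by simp
  moreover have "pmf (poisson_pmf rate) m * real (m choose n) = 0" if "m < n" for m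
    using that by (simp add: binomial_eq_0)
  ultimately show ?thesis by (subst (asm) sums_zero_iff_shift) auto
qed

text \<open>
  First moment bound. If at least \<open>n\<close> balls are needed, some \<open>n\<close> of the balls are irredundant. When the configurations of \<open>n\<close>
  irredundant centres are covered by \<open>K\<close> products of cells of volume at most \<open>v\<close>, each \<open>n\<close>-element
  index set is irredundant with probability at most \<open>K * v ^ n\<close>; the expected number of \<open>n\<close>-element
  index sets is given by the binomial moment.
\<close>

lemma cover_prob_le:
  fixes A :: "'b \<Rightarrow> (real ^ 'n) set" and \<G> :: "nat set \<Rightarrow> (nat \<Rightarrow> 'b) set"
  assumes n: "n \<ge> 2" and c: "AE \<omega> in M. R 1 \<omega> = c"
    and A: "\<And>b. A b \<in> sets borel" "\<And>b. measure lborel (unit_cube \<inter> A b) \<le> v"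
    and fin: "\<And>I. finite I \<Longrightarrow> card I = n \<Longrightarrow> finite (\<G> I)"
    and card: "\<And>I. finite I \<Longrightarrow> card I = n \<Longrightarrow> real (card (\<G> I)) \<le> K"
    and cover: "\<And>I x. finite I \<Longrightarrow> card I = n \<Longrightarrow> (\<And>i. i \<in> I \<Longrightarrow> x i \<in> unit_cube) \<Longrightarrow>
       irredundant nrm x (\<lambda>_. c) I \<Longrightarrow> \<exists>g\<in>\<G> I. \<forall>i\<in>I. x i \<in> A (g i)"
  shows "cover_prob M nrm \<xi> R N n \<le> rate ^ n / fact n * (K * v ^ n)"
proof -
  define \<I> where "\<I> m = {I. I \<subseteq> {1..m} \<and> card I = n}" for m :: nat
  define E where "E m I g = {\<omega> \<in> space M. N \<omega> = m \<and> (\<forall>i\<in>I. \<xi> i \<omega> \<in> A (g i))}" for m I g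
  define U where "U m = (\<Union>I\<in>\<I> m. \<Union>g\<in>\<G> I. E m I g)" for m
  have v: "v \<ge> 0" using A(2) measure_nonneg order_trans by blast
  have \<I>: "finite (\<I> m)" "card (\<I> m) = m choose n" for m
    using n_subsets[of "{1..m}" n] unfolding \<I>_def by (auto intro: finite_subset[of _ "Pow {1..m}"])
  have I: "finite I" "I \<subseteq> {1..}" "card I = n" if "I \<in> \<I> m" for m I
    using that finite_subset[of I "{1..m}"] unfolding \<I>_def by auto
  have E: "E m I g \<in> events" "prob (E m I g) \<le> pmf (poisson_pmf rate) m * v ^ n" if "I \<in> \<I> m" for m I g
  proof -
    show "E m I g \<in> events" unfolding E_def using I[OF that] A by (intro prob_number_centres) auto
    have "prob (E m I g) = pmf (poisson_pmf rate) m * (\<Prod>i\<in>I. measure lborel (unit_cube \<inter> A (g i)))"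
      unfolding E_def using I[OF that] A by (intro prob_number_centres) auto
    also have "\<dots> \<le> pmf (poisson_pmf rate) m * (\<Prod>i\<in>I. v)"
      using A by (intro mult_left_mono prod_mono) auto
    finally show "prob (E m I g) \<le> pmf (poisson_pmf rate) m * v ^ n" using I[OF that] by simp
  qed
  have Uev: "U m \<in> events" for m
    unfolding U_def using \<I> I fin E by (intro sets.finite_UN) auto
  have U: "prob (U m) \<le> pmf (poisson_pmf rate) m * real (m choose n) * (K * v ^ n)" for m
  proof -
    have "prob (U m) \<le> (\<Sum>I\<in>\<I> m. prob (\<Union>g\<in>\<G> I. E m I g))"
      unfolding U_def using \<I> I fin E
      by (intro finite_measure_subadditive_finite) (auto intro!: sets.finite_UN)
    also have "\<dots> \<le> (\<Sum>I\<in>\<I> m. K * (pmf (poisson_pmf rate) m * v ^ n))"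
    proof (rule sum_mono)
      fix I assume II: "I \<in> \<I> m"
      have "prob (\<Union>g\<in>\<G> I. E m I g) \<le> (\<Sum>g\<in>\<G> I. prob (E m I g))"
        using I[OF II] fin E II by (intro finite_measure_subadditive_finite) auto
      also have "\<dots> \<le> (\<Sum>g\<in>\<G> I. pmf (poisson_pmf rate) m * v ^ n)"
        using E II by (intro sum_mono) auto
      also have "\<dots> \<le> K * (pmf (poisson_pmf rate) m * v ^ n)"
        using card I[OF II] v by (auto intro!: mult_right_mono)
      finally show "prob (\<Union>g\<in>\<G> I. E m I g) \<le> K * (pmf (poisson_pmf rate) m * v ^ n)" .
    qed
    finally show ?thesis using \<I> by (simp add: mult_ac)
  qed
  have sums: "(\<lambda>m. pmf (poisson_pmf rate) m * real (m choose n) * (K * v ^ n)) sums (rate ^ n / fact n * (K * v ^ n))"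
    by (intro sums_mult2 poisson_binomial_moment)
  have summ: "summable (\<lambda>m. prob (U m))"
    using U by (intro summable_comparison_test'[OF sums_summable[OF sums]]) auto
  have "cover_prob M nrm \<xi> R N n \<le> prob (\<Union>m. U m)"
    unfolding cover_prob_def
  proof (rule finite_measure_mono_AE)
    show "(\<Union>m. U m) \<in> events" using Uev by auto
    show "AE \<omega> in M. \<omega> \<in> {\<omega> \<in> space M. n \<le> cover_number nrm (\<lambda>i. \<xi> i \<omega>) (\<lambda>i. R i \<omega>) (N \<omega>)}
        \<longrightarrow> \<omega> \<in> (\<Union>m. U m)"
      using AE_centres_in_cube AE_radii_eq[OF c]
    proof eventually_elim
      case (elim \<omega>)
      show ?case
      proof
        assume \<omega>: "\<omega> \<in> {\<omega> \<in> space M. n \<le> cover_number nrm (\<lambda>i. \<xi> i \<omega>) (\<lambda>i. R i \<omega>) (N \<omega>)}"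
        then obtain I where I': "I \<subseteq> {1..N \<omega>}" "card I = n"
            "irredundant nrm (\<lambda>i. \<xi> i \<omega>) (\<lambda>i. R i \<omega>) I"
          using irredundant_of_cover_number_ge[OF n] by blast
        then have "I \<in> \<I> (N \<omega>)" by (simp add: \<I>_def)
        note II = I[OF this]
        have R: "R i \<omega> = c" if "i \<in> I" for i using that II elim(2) by auto
        have "irredundant nrm (\<lambda>i. \<xi> i \<omega>) (\<lambda>_. c) I"
          using I'(3) R unfolding irredundant_def uncovered_def by auto
        then obtain g where "g \<in> \<G> I" "\<forall>i\<in>I. \<xi> i \<omega> \<in> A (g i)"
          using cover[OF II(1,3), of "\<lambda>i. \<xi> i \<omega>"] elim(1) II(2) by auto
        then have "\<omega> \<in> E (N \<omega>) I g" using \<omega> unfolding E_def by auto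
        then show "\<omega> \<in> (\<Union>m. U m)"
          unfolding U_def using \<open>I \<in> \<I> (N \<omega>)\<close> \<open>g \<in> \<G> I\<close> by blast
      qed
    qed
  qed
  also have "\<dots> \<le> (\<Sum>m. prob (U m))"
    using Uev summ by (intro finite_measure_subadditive_countably) auto
  also have "\<dots> \<le> (\<Sum>m. pmf (poisson_pmf rate) m * real (m choose n) * (K * v ^ n))"
    using U summ sums by (intro suminf_le) (auto simp: sums_iff)
  also have "\<dots> = rate ^ n / fact n * (K * v ^ n)"
    using sums by (simp add: sums_iff)
  finally show ?thesis .
qed

text \<open>
  Restrict to \<open>N = n\<close> with exactly one centre in each of the sets \<open>Q 1\<close>, ..., \<open>Q n\<close>. The witnesses force these sets
  to be pairwise disjoint, so the \<open>n!\<close> ways to distribute the centres are disjoint events; their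
  number cancels the \<open>n!\<close> in the Poisson weight.
\<close>

lemma cover_prob_ge:
  assumes n: "n \<ge> 1" and c: "AE \<omega> in M. R 1 \<omega> = c"
    and cont: "continuous_on UNIV nrm"
    and Q: "\<And>i. i \<in> {1..n} \<Longrightarrow> Q i \<in> sets borel" "\<And>i. i \<in> {1..n} \<Longrightarrow> Q i \<subseteq> unit_cube"
      "\<And>i. i \<in> {1..n} \<Longrightarrow> v \<le> measure lborel (Q i)"
    and v: "v \<ge> 0"
    and y: "\<And>i. i \<in> {1..n} \<Longrightarrow> y i \<in> unit_cube"
    and near: "\<And>i x. i \<in> {1..n} \<Longrightarrow> x \<in> Q i \<Longrightarrow> nrm (y i - x) \<le> c"
    and far: "\<And>i j x. i \<in> {1..n} \<Longrightarrow> j \<in> {1..n} \<Longrightarrow> j \<noteq> i \<Longrightarrow> x \<in> Q j \<Longrightarrow> c < nrm (y i - x)"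
  shows "exp (- rate) * (rate * v) ^ n \<le> cover_prob M nrm \<xi> R N n"
proof -
  define \<S> where "\<S> = {\<pi>. \<pi> permutes {1..n}}"
  define E where "E \<pi> = {\<omega> \<in> space M. N \<omega> = n \<and> (\<forall>i\<in>{1..n}. \<xi> i \<omega> \<in> Q (\<pi> i))}" for \<pi>
  have \<S>: "finite \<S>" "card \<S> = fact n"
    unfolding \<S>_def by (auto simp: finite_permutations card_permutations)
  have mem: "\<pi> i \<in> {1..n}" if "\<pi> \<in> \<S>" "i \<in> {1..n}" for \<pi> i
    using that permutes_in_image[of \<pi> "{1..n}"] unfolding \<S>_def by blast
  have E: "E \<pi> \<in> events" "pmf (poisson_pmf rate) n * v ^ n \<le> prob (E \<pi>)" if "\<pi> \<in> \<S>" for \<pi>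
  proof -
    have bor: "Q (\<pi> i) \<in> sets borel" if "i \<in> {1..n}" for i
      using Q(1) mem[OF \<open>\<pi> \<in> \<S>\<close>] that by blast
    show "E \<pi> \<in> events" unfolding E_def using bor by (intro prob_number_centres) auto
    have eq: "prob (E \<pi>) = pmf (poisson_pmf rate) n * (\<Prod>i\<in>{1..n}. measure lborel (unit_cube \<inter> Q (\<pi> i)))"
      unfolding E_def using bor by (intro prob_number_centres) auto
    have "v \<le> measure lborel (unit_cube \<inter> Q (\<pi> i))" if "i \<in> {1..n}" for i
      using Q(2,3)[OF mem[OF \<open>\<pi> \<in> \<S>\<close> that]] by (simp add: Int_absorb1)
    then have "(\<Prod>i\<in>{1..n}. v) \<le> (\<Prod>i\<in>{1..n}. measure lborel (unit_cube \<inter> Q (\<pi> i)))"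
      using v by (intro prod_mono) auto
    then show "pmf (poisson_pmf rate) n * v ^ n \<le> prob (E \<pi>)"
      unfolding eq by (intro mult_left_mono) auto
  qed
  have disj: "disjoint_family_on E \<S>"
  proof (unfold disjoint_family_on_def, intro ballI impI)
    fix \<pi> \<sigma> assume \<pi>\<sigma>: "\<pi> \<in> \<S>" "\<sigma> \<in> \<S>" "\<pi> \<noteq> \<sigma>"
    then obtain i where i: "\<pi> i \<noteq> \<sigma> i" by blast
    then have i': "i \<in> {1..n}" using \<pi>\<sigma> unfolding \<S>_def by (auto simp: permutes_def)
    have "Q (\<pi> i) \<inter> Q (\<sigma> i) = {}"
      using near[OF mem[OF \<pi>\<sigma>(1) i']] far[OF mem[OF \<pi>\<sigma>(1) i'] mem[OF \<pi>\<sigma>(2) i'] i[symmetric]]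
      by fastforce
    then show "E \<pi> \<inter> E \<sigma> = {}" using i' unfolding E_def by blast
  qed
  have "exp (- rate) * (rate * v) ^ n = (\<Sum>\<pi>\<in>\<S>. pmf (poisson_pmf rate) n * v ^ n)"
    using \<S> rate_pos by (simp add: power_mult_distrib field_simps)
  also have "\<dots> \<le> (\<Sum>\<pi>\<in>\<S>. prob (E \<pi>))"
    using E by (intro sum_mono)
  also have "\<dots> = prob (\<Union>\<pi>\<in>\<S>. E \<pi>)"
    using E \<S> disj by (intro finite_measure_finite_Union[symmetric]) auto
  also have "\<dots> \<le> cover_prob M nrm \<xi> R N n"
    unfolding cover_prob_def
  proof (rule finite_measure_mono_AE)
    show "{\<omega> \<in> space M. n \<le> cover_number nrm (\<lambda>i. \<xi> i \<omega>) (\<lambda>i. R i \<omega>) (N \<omega>)} \<in> events"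
      by (intro measurable_cover_number_ge cont measurable_centre measurable_radius number_measurable)
    show "AE \<omega> in M. \<omega> \<in> (\<Union>\<pi>\<in>\<S>. E \<pi>) \<longrightarrow>
       \<omega> \<in> {\<omega> \<in> space M. n \<le> cover_number nrm (\<lambda>i. \<xi> i \<omega>) (\<lambda>i. R i \<omega>) (N \<omega>)}"
      using AE_radii_eq[OF c]
    proof eventually_elim
      case (elim \<omega>)
      show ?case
      proof
        assume "\<omega> \<in> (\<Union>\<pi>\<in>\<S>. E \<pi>)"
        then obtain \<pi> where \<pi>: "\<pi> \<in> \<S>" and \<omega>: "\<omega> \<in> space M" "N \<omega> = n"
          "\<And>i. i \<in> {1..n} \<Longrightarrow> \<xi> i \<omega> \<in> Q (\<pi> i)" unfolding E_def by blast
        have "irredundant nrm (\<lambda>i. \<xi> i \<omega>) (\<lambda>i. R i \<omega>) {1..n}"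
          unfolding irredundant_def uncovered_def
        proof (intro ballI bexI conjI)
          fix i assume i: "i \<in> {1..n}"
          note pi = mem[OF \<pi> i]
          show "y (\<pi> i) \<in> unit_cube" by (rule y[OF pi])
          show "nrm (y (\<pi> i) - \<xi> i \<omega>) \<le> R i \<omega>" using near[OF pi \<omega>(3)[OF i]] elim i by simp
          fix j assume j: "j \<in> {1..n} - {i}"
          then have "\<pi> j \<noteq> \<pi> i" using \<pi> permutes_inj[of \<pi>] unfolding \<S>_def by (auto dest: injD)
          then show "R j \<omega> < nrm (y (\<pi> i) - \<xi> j \<omega>)"
            using far[OF pi mem[OF \<pi>, of j] _ \<omega>(3)[of j]] j elim by simp
        qed
        then show "\<omega> \<in> {\<omega> \<in> space M. n \<le> cover_number nrm (\<lambda>i. \<xi> i \<omega>) (\<lambda>i. R i \<omega>) (N \<omega>)}"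
          using cover_number_ge_of_irredundant[OF n] \<omega> by simp
      qed
    qed
  qed
  finally show ?thesis .
qed

end

section \<open>Grid cells visited by an irredundant family\<close>

text \<open>
  The property of the norm behind the upper bound. Step lengths are limited to \<open>1 / B\<close> with \<open>B\<close> a natural
  number, so that slabs of width \<open>1 / B\<close> partition the cube.
\<close>

definition axis_descent :: "(real ^ 'n \<Rightarrow> real) \<Rightarrow> real \<Rightarrow> nat \<Rightarrow> real \<Rightarrow> bool" where
  "axis_descent nrm c B \<eta> \<longleftrightarrow> (\<forall>w. nrm w \<le> c \<longrightarrow> (\<exists>k. \<exists>s\<in>{1, -1}. \<forall>t. 0 \<le> t \<and> t * real B \<le> 1 \<longrightarrow>
     nrm (w - (t * s) *\<^sub>R axis k 1) \<le> c - \<eta> * t))"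

definition grid_cell :: "nat \<Rightarrow> ('n \<Rightarrow> nat) \<Rightarrow> (real ^ 'n) set" where
  "grid_cell m p = cbox (\<chi> j. real (p j) / m) (\<chi> j. (real (p j) + 1) / m)"

lemma grid_cell_borel: "grid_cell m p \<in> sets borel"
  unfolding grid_cell_def by simp

lemma measure_grid_cell_le:
  assumes "m > 0"
  shows "measure lborel (unit_cube \<inter> grid_cell m p :: (real ^ 'n) set) \<le> (1 / real m) ^ CARD('n)"
proof -
  have "measure lborel (unit_cube \<inter> grid_cell m p :: (real ^ 'n) set) \<le> measure lborel (grid_cell m p :: (real ^ 'n) set)"
    unfolding grid_cell_def by (intro measure_mono_fmeasurable) (auto intro: fmeasurable_cbox)
  also have "\<dots> = (\<Prod>j\<in>(UNIV :: 'n set). 1 / real m)"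
    unfolding grid_cell_def using assms
    by (subst content_cbox_cart)
       (auto simp: interval_ne_empty_cart divide_right_mono diff_divide_distrib[symmetric])
  finally show ?thesis by simp
qed

lemma mem_grid_cell:
  assumes "m > 0" "x \<in> unit_cube"
  shows "x \<in> grid_cell m (\<lambda>j. nat \<lfloor>real m * x $ j\<rfloor>)"
proof -
  have "real (nat \<lfloor>real m * x $ j\<rfloor>) \<le> real m * x $ j \<and> real m * x $ j \<le> real (nat \<lfloor>real m * x $ j\<rfloor>) + 1" for j
  proof -
    have "0 \<le> x $ j" using assms(2) by (simp add: mem_box_cart)
    then have "0 \<le> real m * x $ j" by simp
    then show ?thesis by linarith
  qed
  then show ?thesis using assms(1) unfolding grid_cell_def mem_box_cart
    by (simp add: field_simps)
qed

text \<open>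
  The label \<open>(k, s, b, p)\<close> of a centre \<open>x\<close>: the descent direction of its witness is \<open>s * e\<^sub>k\<close>, the
  number \<open>b\<close> is that of the slab of width \<open>1 / B\<close> that contains \<open>x $ k\<close>, and \<open>p\<close> lists the numbers of the
  grid cell of side \<open>1 / m\<close> in the coordinates other than \<open>k\<close>. The value \<open>0\<close> at \<open>k\<close> is a placeholder; since
  the \<open>k\<close>-th grid coordinate is left open, there are only \<open>O(m\<^bsup>d-1\<^esup>)\<close> labels.
\<close>

definition direction_cells :: "nat \<Rightarrow> nat \<Rightarrow> ('n::finite \<times> real \<times> nat \<times> ('n \<Rightarrow> nat)) set" where
  "direction_cells B m =
     (SIGMA k:UNIV. {1, -1} \<times> {..B} \<times> PiE UNIV (\<lambda>j. if j = k then {0} else {..m}))"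

lemma finite_direction_cells: "finite (direction_cells B m)"
  unfolding direction_cells_def by (intro finite_SigmaI finite_cartesian_product finite_PiE) auto

lemma card_direction_cells:
  "card (direction_cells B m :: ('n::finite \<times> real \<times> nat \<times> ('n \<Rightarrow> nat)) set)
    = CARD('n) * 2 * (B + 1) * (m + 1) ^ (CARD('n) - 1)"
proof -
  have 1: "card (PiE (UNIV :: 'n set) (\<lambda>j. if j = k then {0} else {..m})) = (m + 1) ^ (CARD('n) - 1)" for k
  proof -
    have "card (PiE (UNIV :: 'n set) (\<lambda>j. if j = k then {0} else {..m})) =
      (\<Prod>j\<in>(UNIV :: 'n set). card (if j = k then {0} else {..m}))"
      by (simp add: card_PiE)
    also have "\<dots> = (\<Prod>j\<in>UNIV - {k}. card (if j = k then {0} else {..m}))"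
      by (subst prod.remove[of _ k]) auto
    also have "\<dots> = (\<Prod>j\<in>UNIV - {k}. m + 1)" by (intro prod.cong) auto
    finally show ?thesis by (simp add: card_Diff_singleton)
  qed
  have "card (direction_cells B m :: ('n::finite \<times> real \<times> nat \<times> ('n \<Rightarrow> nat)) set)
    = (\<Sum>k\<in>(UNIV :: 'n set). card ({1, -1 :: real} \<times> {..B} \<times> PiE UNIV (\<lambda>j. if j = k then {0} else {..m})))"
    unfolding direction_cells_def
    by (intro card_SigmaI ballI finite_cartesian_product) (auto intro!: finite_PiE)
  then show ?thesis by (simp add: card_cartesian_product 1 algebra_simps)
qed

text \<open>
  Let \<open>x\<close> and \<open>x'\<close> carry the same label, with witnesses \<open>x + w\<close> and \<open>x' + w'\<close>, and let \<open>x'\<close> be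
  ahead of \<open>x\<close> by \<open>t\<close> in the direction \<open>s * e\<^sub>k\<close>. Seen from \<open>x'\<close>, the first witness is \<open>w\<close> moved by \<open>t\<close> along the
  descent direction, up to an error of at most \<open>1 / m\<close> in each other coordinate. Hence its distance from \<open>x'\<close> is at most
  \<open>c - \<eta> * t + d / m\<close>, and as this must exceed \<open>c\<close>, the gap \<open>t\<close> is smaller than \<open>d / (\<eta> * m)\<close>. If \<open>x\<close> is
  ahead, exchange the roles.
\<close>

lemma same_cell_close:
  fixes nrm :: "real ^ 'n \<Rightarrow> real" and x x' w w' :: "real ^ 'n"
  assumes tri: "\<And>a b. nrm (a + b) \<le> nrm a + nrm b"
    and small: "\<And>e \<delta>. (\<And>j. \<bar>e $ j\<bar> \<le> \<delta>) \<Longrightarrow> nrm e \<le> real CARD('n) * \<delta>"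
    and \<eta>: "\<eta> > 0" and m: "m > 0"
    and s: "s \<in> {1, -1 :: real}"
    and w: "\<And>t. 0 \<le> t \<and> t * real B \<le> 1 \<Longrightarrow> nrm (w - (t * s) *\<^sub>R axis k 1) \<le> c - \<eta> * t"
    and w': "\<And>t. 0 \<le> t \<and> t * real B \<le> 1 \<Longrightarrow> nrm (w' - (t * s) *\<^sub>R axis k 1) \<le> c - \<eta> * t"
    and far: "nrm (x + w - x') > c" and far': "nrm (x' + w' - x) > c"
    and near: "\<bar>x' $ k - x $ k\<bar> * real B \<le> 1" "\<And>j. j \<noteq> k \<Longrightarrow> \<bar>x' $ j - x $ j\<bar> \<le> 1 / m"
  shows "\<bar>x' $ k - x $ k\<bar> * real m < CARD('n) / \<eta>"
proof -
  have main: "s * (b $ k - a $ k) * real m < CARD('n) / \<eta>"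
    if u: "\<And>t. 0 \<le> t \<and> t * real B \<le> 1 \<Longrightarrow> nrm (u - (t * s) *\<^sub>R axis k 1) \<le> c - \<eta> * t"
    and far: "nrm (a + u - b) > c" and pos: "0 \<le> s * (b $ k - a $ k)"
    and near: "\<bar>b $ k - a $ k\<bar> * real B \<le> 1" "\<And>j. j \<noteq> k \<Longrightarrow> \<bar>b $ j - a $ j\<bar> \<le> 1 / m"
    for a b u
  proof -
    define t where "t = s * (b $ k - a $ k)"
    define e where "e = a - b + (t * s) *\<^sub>R axis k 1"
    have "t = \<bar>b $ k - a $ k\<bar>" using pos s unfolding t_def by auto
    then have t: "0 \<le> t \<and> t * real B \<le> 1" using near(1) by simp
    have "t * s = b $ k - a $ k" using s unfolding t_def by auto
    then have "\<bar>e $ j\<bar> \<le> 1 / m" for j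
      using near(2)[of j] unfolding e_def by (cases "j = k") (auto simp: axis_def abs_minus_commute)
    then have "nrm e \<le> real CARD('n) * (1 / m)" by (rule small)
    moreover have "c < nrm ((u - (t * s) *\<^sub>R axis k 1) + e)"
      using far unfolding e_def by (simp add: algebra_simps)
    ultimately have "c < c - \<eta> * t + real CARD('n) * (1 / m)"
      using tri[of "u - (t * s) *\<^sub>R axis k 1" e] u[OF t] by linarith
    then have "t * real m < CARD('n) / \<eta>" using \<eta> m by (simp add: field_simps)
    then show ?thesis unfolding t_def .
  qed
  show ?thesis
  proof (cases "0 \<le> s * (x' $ k - x $ k)")
    case True
    have "s * (x' $ k - x $ k) = \<bar>x' $ k - x $ k\<bar>" using s True by auto
    then show ?thesis using main[OF w far True near] by metis
  next
    case False
    have eq: "s * (x $ k - x' $ k) = \<bar>x' $ k - x $ k\<bar>" using s False by auto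
    have "s * (x $ k - x' $ k) * real m < CARD('n) / \<eta>"
      using near by (intro main[OF w' far']) (auto simp: eq abs_minus_commute)
    then show ?thesis using eq by metis
  qed
qed

lemma same_floor_diff:
  fixes a b :: real
  assumes "0 \<le> a" "0 \<le> b" "nat \<lfloor>a\<rfloor> = nat \<lfloor>b\<rfloor>"
  shows "\<bar>a - b\<bar> \<le> 1"
proof -
  have "\<lfloor>a\<rfloor> = \<lfloor>b\<rfloor>" using assms by (metis eq_nat_nat_iff zero_le_floor)
  then show ?thesis by linarith
qed

text \<open>
  In an irredundant family, centres with the same label have almost the same \<open>k\<close>-th coordinate. A grid cell is therefore
  encoded by the label \<open>q i\<close> of the centre, one reference height \<open>h\<close> for each label, and a bounded deviation
  \<open>a i\<close> from it. The deviation is shifted by \<open>C\<close> to be a natural number. Only the heights, one per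
  label and not one per centre, range over \<open>m + 1\<close> values.
\<close>

definition cell_assignments ::
  "nat \<Rightarrow> nat \<Rightarrow> nat \<Rightarrow> nat set \<Rightarrow> (nat \<Rightarrow> 'n::finite \<Rightarrow> nat) set" where
  "cell_assignments B C m I =
     (\<lambda>(q, h, a). \<lambda>i\<in>I. \<lambda>j. let (k, s, b, p) = q i in if j = k then h (q i) + a i - C else p j) `
       ((I \<rightarrow>\<^sub>E direction_cells B m) \<times> (direction_cells B m \<rightarrow>\<^sub>E {..m}) \<times> (I \<rightarrow>\<^sub>E {..2 * C}))"

lemma finite_cell_assignments:
  "finite I \<Longrightarrow> finite (cell_assignments B C m I)"
  unfolding cell_assignments_def
  by (intro finite_imageI finite_cartesian_product finite_PiE finite_direction_cells) auto

lemma card_cell_assignments_le: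
  fixes I :: "nat set"
  assumes "finite I"
  shows "card (cell_assignments B C m I :: (nat \<Rightarrow> 'n::finite \<Rightarrow> nat) set) \<le>
    (card (direction_cells B m :: ('n \<times> real \<times> nat \<times> ('n \<Rightarrow> nat)) set)) ^ card I
      * ((m + 1) ^ card (direction_cells B m :: ('n \<times> real \<times> nat \<times> ('n \<Rightarrow> nat)) set)
      * (2 * C + 1) ^ card I)"
  unfolding cell_assignments_def using assms finite_direction_cells
  by (intro card_image_le[THEN order_trans] finite_cartesian_product finite_PiE)
     (auto simp: card_cartesian_product card_PiE)

text \<open>
  Choose for each centre a descent direction of its witness and label it accordingly; the reference
  height of a label is that of an arbitrary centre with this label.
\<close>

lemma irredundant_cell_assignment:
  fixes nrm :: "real ^ 'n \<Rightarrow> real"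
  assumes tri: "\<And>a b. nrm (a + b) \<le> nrm a + nrm b"
    and small: "\<And>e \<delta>. (\<And>j. \<bar>e $ j\<bar> \<le> \<delta>) \<Longrightarrow> nrm e \<le> real CARD('n) * \<delta>"
    and desc: "axis_descent nrm c B \<eta>" and \<eta>: "\<eta> > 0" and m: "m > 0"
    and C: "CARD('n) / \<eta> \<le> real C"
    and I: "finite I"
    and cube: "\<And>i. i \<in> I \<Longrightarrow> x i \<in> unit_cube"
    and irr: "irredundant nrm x (\<lambda>_. c) I"
  shows "\<exists>g\<in>cell_assignments B C m I. \<forall>i\<in>I. x i \<in> grid_cell m (g i)"
proof -
  have "\<exists>w. nrm w \<le> c \<and> (\<forall>j\<in>I - {i}. c < nrm (x i + w - x j))" if i: "i \<in> I" for i
  proof -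
    obtain y where "nrm (y - x i) \<le> c" "\<forall>j\<in>I - {i}. c < nrm (y - x j)"
      using irr i unfolding irredundant_def uncovered_def by blast
    then show ?thesis by (intro exI[of _ "y - x i"]) auto
  qed
  then obtain w where w: "\<And>i. i \<in> I \<Longrightarrow> nrm (w i) \<le> c"
    "\<And>i j. i \<in> I \<Longrightarrow> j \<in> I \<Longrightarrow> j \<noteq> i \<Longrightarrow> c < nrm (x i + w i - x j)"
    by (metis DiffI singletonD)
  have "\<exists>k s. s \<in> {1, -1} \<and> (\<forall>t. 0 \<le> t \<and> t * real B \<le> 1 \<longrightarrow>
     nrm (w i - (t * s) *\<^sub>R axis k 1) \<le> c - \<eta> * t)" if "i \<in> I" for i
    using desc w(1)[OF that] unfolding axis_descent_def by blast
  then obtain k s where ks: "\<And>i. i \<in> I \<Longrightarrow> s i \<in> {1, -1 :: real}"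
    "\<And>i t. i \<in> I \<Longrightarrow> 0 \<le> t \<and> t * real B \<le> 1 \<Longrightarrow>
     nrm (w i - (t * s i) *\<^sub>R axis (k i) 1) \<le> c - \<eta> * t"
    by metis
  have x: "0 \<le> x i $ j" "x i $ j \<le> 1" if "i \<in> I" for i j
    using cube[OF that] by (auto simp: mem_box_cart)
  define f where "f i j = nat \<lfloor>real m * x i $ j\<rfloor>" for i j
  have f: "f i j \<le> m" if "i \<in> I" for i j
  proof -
    have "real m * x i $ j \<le> real m * 1" using x[OF that] by (intro mult_left_mono) auto
    then show ?thesis unfolding f_def by linarith
  qed
  define q where "q i = (k i, s i, nat \<lfloor>real B * x i $ k i\<rfloor>, \<lambda>j. if j = k i then 0 else f i j)" for i
  have q: "q i \<in> direction_cells B m" if i: "i \<in> I" for i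
  proof -
    have "real B * x i $ k i \<le> real B * 1" using x[OF i] by (intro mult_left_mono) auto
    then have "nat \<lfloor>real B * x i $ k i\<rfloor> \<le> B" by linarith
    then show ?thesis unfolding q_def direction_cells_def using f ks(1) i by auto
  qed
  (* A representative centre for each label that occurs. *)
  define rep where "rep c = (SOME i. i \<in> I \<and> q i = c)" for c
  have rep: "rep (q i) \<in> I" "q (rep (q i)) = q i" if "i \<in> I" for i
    using someI[of "\<lambda>i'. i' \<in> I \<and> q i' = q i" i] that unfolding rep_def by auto
  have close: "f i (k i) \<le> f j (k i) + C" if ij: "i \<in> I" "j \<in> I" "q i = q j" for i j
  proof (cases "i = j")
    case False
    have keq: "k j = k i" "s j = s i" using ij(3) unfolding q_def by auto
    have kn: "nat \<lfloor>real B * x i $ k i\<rfloor> = nat \<lfloor>real B * x j $ k i\<rfloor>"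
      using ij(3) keq unfolding q_def by auto
    have fn: "f i l = f j l" if "l \<noteq> k i" for l
      using ij(3) keq that unfolding q_def by (auto dest: fun_cong[of _ _ l])
    have "\<bar>x j $ k i - x i $ k i\<bar> * real m < CARD('n) / \<eta>"
    proof (rule same_cell_close[OF tri small \<eta> m])
      show "s i \<in> {1, -1}" using ks ij by blast
      show "nrm (w i - (t * s i) *\<^sub>R axis (k i) 1) \<le> c - \<eta> * t" if "0 \<le> t \<and> t * real B \<le> 1" for t
        using ks(2)[OF ij(1) that] .
      show "nrm (w j - (t * s i) *\<^sub>R axis (k i) 1) \<le> c - \<eta> * t" if "0 \<le> t \<and> t * real B \<le> 1" for t
        using ks(2)[OF ij(2) that] keq by simp
      show "c < nrm (x i + w i - x j)" "c < nrm (x j + w j - x i)" using w(2) ij False by auto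
      have "\<bar>real B * x j $ k i - real B * x i $ k i\<bar> \<le> 1"
        using x ij kn by (intro same_floor_diff) auto
      then show "\<bar>x j $ k i - x i $ k i\<bar> * real B \<le> 1"
        by (simp add: right_diff_distrib[symmetric] abs_mult mult.commute)
      show "\<bar>x j $ l - x i $ l\<bar> \<le> 1 / real m" if l: "l \<noteq> k i" for l
      proof -
        have "\<bar>real m * x j $ l - real m * x i $ l\<bar> \<le> 1"
          using x ij fn[OF l] unfolding f_def by (intro same_floor_diff) auto
        then have "\<bar>x j $ l - x i $ l\<bar> * real m \<le> 1"
          by (simp add: right_diff_distrib[symmetric] abs_mult mult.commute)
        then show ?thesis using m by (simp add: pos_le_divide_eq)
      qed
    qed auto
    then have "\<bar>real m * x j $ k i - real m * x i $ k i\<bar> < real C"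
      using C by (simp add: right_diff_distrib[symmetric] abs_mult mult.commute)
    then have "real m * x i $ k i < real m * x j $ k i + real C" by linarith
    then show ?thesis unfolding f_def by linarith
  qed auto
  define h where "h = (\<lambda>c\<in>direction_cells B m. if \<exists>i\<in>I. q i = c then f (rep c) (k (rep c)) else 0)"
  define a where "a = (\<lambda>i\<in>I. f i (k i) + C - h (q i))"
  have hq: "h (q i) = f (rep (q i)) (k i)" if i: "i \<in> I" for i
  proof -
    have "k (rep (q i)) = k i" using rep[OF i] unfolding q_def by simp
    then show ?thesis using i q[OF i] unfolding h_def by auto
  qed
  have hC: "h (q i) \<le> f i (k i) + C" "f i (k i) \<le> h (q i) + C" if i: "i \<in> I" for i
  proof -
    have "k (rep (q i)) = k i" using rep[OF i] unfolding q_def by simp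
    then show "h (q i) \<le> f i (k i) + C" "f i (k i) \<le> h (q i) + C"
      using close[OF rep(1)[OF i] i rep(2)[OF i]] close[OF i rep(1)[OF i] rep(2)[OF i, symmetric]]
        hq[OF i] by auto
  qed
  define g where "g = (\<lambda>i\<in>I. \<lambda>j. let (k, s, b, p) = restrict q I i in if j = k then h (restrict q I i) + a i - C else p j)"
  have "h \<in> direction_cells B m \<rightarrow>\<^sub>E {..m}"
  proof -
    have "f (rep z) (k (rep z)) \<le> m" if "i \<in> I" "q i = z" for i z
      using f[OF rep(1)[OF that(1)]] that(2) by simp
    then show ?thesis unfolding h_def by (auto simp: PiE_iff)
  qed
  moreover have "a \<in> I \<rightarrow>\<^sub>E {..2 * C}"
  proof -
    have "f i (k i) + C - h (q i) \<le> 2 * C" if "i \<in> I" for i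
      using hC(2)[OF that] by linarith
    then show ?thesis unfolding a_def by (auto simp: PiE_iff)
  qed
  moreover have "restrict q I \<in> I \<rightarrow>\<^sub>E direction_cells B m" using q by auto
  ultimately have "g \<in> cell_assignments B C m I"
    unfolding cell_assignments_def g_def
    by (intro image_eqI[of _ _ "(restrict q I, h, a)"]) auto
  moreover have "x i \<in> grid_cell m (g i)" if i: "i \<in> I" for i
  proof -
    have "g i j = f i j" for j
      using i hC[OF i] unfolding g_def a_def by (simp add: q_def)
    then have "g i = f i" by blast
    then show ?thesis using mem_grid_cell[OF m cube[OF i]] unfolding f_def by simp
  qed
  ultimately show ?thesis by blast
qed

section \<open>Comparison on the scale n log n\<close>

text \<open>
  The factor \<open>1 + o(1)\<close> absorbs any \<open>g\<close> of smaller order than \<open>n ln n\<close>.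
\<close>

lemma nlogn_leI:
  assumes a: "a > 0" and f: "\<forall>\<^sub>F n in sequentially. f n \<le> exp (- a * real n * ln (real n) + g n)"
    and g: "(\<lambda>n. g n / (real n * ln (real n))) \<longlonglongrightarrow> 0"
  shows "nlogn_le f a"
  unfolding nlogn_le_def
proof (intro exI conjI)
  show "(\<lambda>n. (- 1 / a) * (g n / (real n * ln (real n)))) \<longlonglongrightarrow> 0"
    using tendsto_mult_right_zero[OF g] .
  show "\<forall>\<^sub>F n in sequentially.
      f n \<le> exp (- a * real n * ln (real n) * (1 + (- 1 / a) * (g n / (real n * ln (real n)))))"
    using f eventually_gt_at_top[of 1]
  proof eventually_elim
    case (elim n)
    then have "- a * real n * ln (real n) * (1 + (- 1 / a) * (g n / (real n * ln (real n))))
       = - a * real n * ln (real n) + g n"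
      using a by (simp add: field_simps)
    then show ?case using elim by simp
  qed
qed

lemma nlogn_geI:
  assumes a: "a > 0" and f: "\<forall>\<^sub>F n in sequentially. exp (- a * real n * ln (real n) + g n) \<le> f n"
    and g: "(\<lambda>n. g n / (real n * ln (real n))) \<longlonglongrightarrow> 0"
  shows "nlogn_ge f a"
  unfolding nlogn_ge_def
proof (intro exI conjI)
  show "(\<lambda>n. (- 1 / a) * (g n / (real n * ln (real n)))) \<longlonglongrightarrow> 0"
    using tendsto_mult_right_zero[OF g] .
  show "\<forall>\<^sub>F n in sequentially.
      f n \<ge> exp (- a * real n * ln (real n) * (1 + (- 1 / a) * (g n / (real n * ln (real n)))))"
    using f eventually_gt_at_top[of 1]
  proof eventually_elim
    case (elim n)
    then have "- a * real n * ln (real n) * (1 + (- 1 / a) * (g n / (real n * ln (real n))))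
       = - a * real n * ln (real n) + g n"
      using a by (simp add: field_simps)
    then show ?case using elim by simp
  qed
qed

text \<open>
  Solving \<open>f n = exp (- a n ln n (1 + \<gamma> n))\<close> for \<open>\<gamma>\<close> is possible because the lower bound makes \<open>f\<close>
  positive; \<open>\<gamma>\<close> then lies between the two error terms.
\<close>

lemma nlogn_eqI:
  assumes a: "a > 0" and le: "nlogn_le f a" and ge: "nlogn_ge f a"
  shows "nlogn_eq f a"
proof -
  obtain \<epsilon> where \<epsilon>: "\<epsilon> \<longlonglongrightarrow> 0"
    "\<forall>\<^sub>F n in sequentially. f n \<le> exp (- a * real n * ln (real n) * (1 + \<epsilon> n))"
    using le unfolding nlogn_le_def by blast
  obtain \<delta> where \<delta>: "\<delta> \<longlonglongrightarrow> 0"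
    "\<forall>\<^sub>F n in sequentially. exp (- a * real n * ln (real n) * (1 + \<delta> n)) \<le> f n"
    using ge unfolding nlogn_ge_def by blast
  define \<gamma> where "\<gamma> n = - ln (f n) / (a * real n * ln (real n)) - 1" for n
  have ev: "\<forall>\<^sub>F n in sequentially. \<epsilon> n \<le> \<gamma> n \<and> \<gamma> n \<le> \<delta> n \<and>
      f n = exp (- a * real n * ln (real n) * (1 + \<gamma> n))"
    using \<epsilon>(2) \<delta>(2) eventually_gt_at_top[of 1]
  proof eventually_elim
    case (elim n)
    define L where "L = a * real n * ln (real n)"
    have L: "L > 0" using a elim(3) unfolding L_def by simp
    have pos: "f n > 0" using elim(2) exp_gt_zero order_less_le_trans by blast
    have 1: "ln (f n) \<le> - L * (1 + \<epsilon> n)"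
      using elim(1) pos ln_le_cancel_iff[of "f n" "exp (- L * (1 + \<epsilon> n))"] unfolding L_def by simp
    have 2: "- L * (1 + \<delta> n) \<le> ln (f n)"
      using elim(2) pos unfolding L_def by (subst ln_ge_iff) auto
    have \<gamma>: "1 + \<gamma> n = - ln (f n) / L" unfolding \<gamma>_def L_def by simp
    have "1 + \<epsilon> n \<le> 1 + \<gamma> n" "1 + \<gamma> n \<le> 1 + \<delta> n"
      unfolding \<gamma> using 1 2 L by (simp_all add: field_simps)
    moreover have "f n = exp (- L * (1 + \<gamma> n))" unfolding \<gamma> using L pos by simp
    ultimately show ?case unfolding L_def by simp
  qed
  have "\<gamma> \<longlonglongrightarrow> 0"
    by (rule tendsto_sandwich[OF _ _ \<epsilon>(1) \<delta>(1)]) (use ev in \<open>auto elim: eventually_mono\<close>)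
  then show ?thesis unfolding nlogn_eq_def using ev by (auto elim: eventually_mono)
qed

section \<open>The upper bound\<close>

text \<open>
  The \<open>n\<close>-th term of the exponential series for \<open>exp n\<close> is at most its sum.
\<close>

lemma ln_fact_ge:
  assumes "n \<ge> 1"
  shows "ln (fact n) \<ge> real n * ln (real n) - real n"
proof -
  have "(\<lambda>k. real n ^ k /\<^sub>R fact k) sums exp (real n)" by (rule exp_converges)
  then have "(\<Sum>k\<in>{n}. real n ^ k /\<^sub>R fact k) \<le> exp (real n)"
    using sum_le_suminf[of "\<lambda>k. real n ^ k /\<^sub>R fact k" "{n}"] by (simp add: sums_iff)
  then have "real n ^ n \<le> exp (real n) * fact n" by (simp add: field_simps)
  then have "ln (real n ^ n) \<le> ln (exp (real n) * fact n)"
    using assms by (subst ln_le_cancel_iff) auto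
  then show ?thesis using assms by (simp add: ln_mult ln_realpow)
qed

text \<open>
  Here \<open>D = A * (m + 1) ^ e\<close> is the number of labels and \<open>e\<close> stands for \<open>d - 1\<close>. The labels contribute
  \<open>D ^ n\<close>, of order \<open>m\<^bsup>e n\<^esup>\<close> up to \<open>const\<^sup>n\<close>, against the volume \<open>m\<^bsup>-(e+1) n\<^esup>\<close> of the cells, which leaves \<open>m\<^bsup>-n\<^esup>\<close>. The
  heights cost \<open>(m + 1) ^ D\<close>. Taking \<open>m ^ e\<close> of order \<open>n / ln n\<close>, just below \<open>n\<close>, makes this cost only
  \<open>exp (O(n))\<close>, while \<open>ln m\<close> is still \<open>ln n / e\<close> to leading order.
\<close>

lemma nlogn_le_of_grid_bound:
  fixes f :: "nat \<Rightarrow> real" and A C e :: nat and rate :: real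
  assumes e: "e \<ge> 1" and rate: "rate > 0" and A: "A \<ge> 1"
    and bound: "\<And>n m. n \<ge> 2 \<Longrightarrow> m \<ge> 1 \<Longrightarrow> f n \<le> rate ^ n / fact n *
      (real ((A * (m + 1) ^ e) ^ n * ((m + 1) ^ (A * (m + 1) ^ e) * (2 * C + 1) ^ n)) * ((1 / real m) ^ (e + 1)) ^ n)"
  shows "nlogn_le f (1 + 1 / real e)"
proof -
  define A' where "A' = real A * 2 ^ e"
  have A': "A' \<ge> 1" unfolding A'_def using A by (simp add: mult_ge1_I)
  define K where "K = ln rate + 1 + ln A' + ln (2 * real C + 1) + ln 2"
  define g where "g n = real n * K + real n * ln (ln (real n)) / real e
     + A' * (real n / ln (real n)) * (ln 2 + ln (real n))" for n :: nat
  (* The grid size is the integer part of z n, at least half of it. *)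
  define z where "z n = (real n / ln (real n)) powr (1 / real e)" for n :: nat
  have "real e > 0" using e by simp
  then have "(\<lambda>n. g n / (real n * ln (real n))) \<longlonglongrightarrow> 0"
    unfolding g_def by real_asymp
  moreover have "\<forall>\<^sub>F n in sequentially. f n \<le> exp (- (1 + 1 / real e) * real n * ln (real n) + g n)"
  proof -
    have "\<forall>\<^sub>F n in sequentially. ln (real n) \<ge> 1" "\<forall>\<^sub>F n in sequentially. real n / ln (real n) \<ge> 1"
      by real_asymp+
    then show ?thesis using eventually_ge_at_top[of 2]
    proof eventually_elim
      case (elim n)
      define m where "m = nat \<lfloor>z n\<rfloor>"
      have z: "z n \<ge> 1" unfolding z_def using elim(2) by (simp add: ge_one_powr_ge_zero)
      have m: "m \<ge> 1" "real m \<le> z n" "z n / 2 \<le> real m"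
        proof -
        show "m \<ge> 1" "real m \<le> z n" using z unfolding m_def by linarith+
        moreover have "z n - 1 < real m" using z unfolding m_def by linarith
        ultimately show "z n / 2 \<le> real m" by linarith
      qed
      have ze: "z n ^ e = real n / ln (real n)"
        using e z elim unfolding z_def by (simp add: powr_power powr_powr)
      have me: "real m ^ e \<le> real n / ln (real n)"
        unfolding ze[symmetric] using m by (intro power_mono) auto
      have mn: "real m \<le> real n"
      proof -
        have "real m \<le> real m ^ e" using m e by (simp add: self_le_power)
        also have "\<dots> \<le> real n / ln (real n)" by (rule me)
        also have "\<dots> \<le> real n" using elim by (simp add: field_simps mult_left_le)
        finally show ?thesis .
      qed
      define D where "D = A * (m + 1) ^ e"
      have D: "real D \<le> A' * real m ^ e" "real D \<ge> 1"
      proof -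
        have "(real m + 1) ^ e \<le> (2 * real m) ^ e" using m by (intro power_mono) auto
        then show "real D \<le> A' * real m ^ e"
          unfolding D_def A'_def by (simp add: power_mult_distrib mult.assoc add.commute mult_left_mono)
        have "D \<ge> 1 * 1" unfolding D_def using A by (intro mult_mono) auto
        then show "real D \<ge> 1" by simp
      qed
      have lnD: "ln (real D) \<le> ln A' + real e * ln (real m)"
      proof -
        have "ln (real D) \<le> ln (A' * real m ^ e)" using D by (subst ln_le_cancel_iff) linarith+
        also have "\<dots> = ln A' + real e * ln (real m)" using A' m by (simp add: ln_mult ln_realpow)
        finally show ?thesis .
      qed
      have lnm: "ln (real m) \<ge> (ln (real n) - ln (ln (real n))) / real e - ln 2"
      proof -
        have "ln (z n) = (ln (real n) - ln (ln (real n))) / real e"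
          unfolding z_def using elim by (simp add: ln_powr ln_div)
        moreover have "ln (z n / 2) \<le> ln (real m)" using m z by (subst ln_le_cancel_iff) auto
        ultimately show ?thesis using z by (simp add: ln_div)
      qed
      have Dm: "real D * ln (real (m + 1)) \<le> A' * (real n / ln (real n)) * (ln 2 + ln (real n))"
      proof (intro mult_mono)
        show "real D \<le> A' * (real n / ln (real n))"
          using D(1) mult_left_mono[OF me, of A'] A' by linarith
        have "ln (real (m + 1)) \<le> ln (2 * real n)" using mn m elim by (subst ln_le_cancel_iff) auto
        then show "ln (real (m + 1)) \<le> ln 2 + ln (real n)" using elim by (simp add: ln_mult)
      qed (use A' elim in auto)
      define rhs where "rhs = rate ^ n / fact n *
        (real (D ^ n * ((m + 1) ^ D * (2 * C + 1) ^ n)) * ((1 / real m) ^ (e + 1)) ^ n)"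
      have rhs: "rhs > 0" unfolding rhs_def using rate D m by simp
      have "ln rhs = real n * ln rate - ln (fact n) + (real n * ln (real D) + (real D * ln (real (m + 1))
         + real n * ln (2 * real C + 1)) - real n * (real (e + 1) * ln (real m)))"
      proof -
        have "ln ((1 / real m) ^ (e + 1)) = - (real (e + 1) * ln (real m))"
          using m by (subst ln_realpow) (simp_all add: ln_div)
        moreover have "ln (2 * real C + 1) = ln (real (2 * C + 1))" by simp
        ultimately show ?thesis
          unfolding rhs_def using rate D m
          by (simp add: ln_mult ln_div ln_realpow del: power_Suc of_nat_Suc of_nat_add)
      qed
      also have "\<dots> \<le> real n * ln rate - (real n * ln (real n) - real n) +
         (real n * (ln A' + real e * ln (real m)) + (A' * (real n / ln (real n)) * (ln 2 + ln (real n))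
         + real n * ln (2 * real C + 1)) - real n * (real (e + 1) * ln (real m)))"
        using ln_fact_ge[of n] elim lnD Dm
        by (intro add_mono diff_mono mult_left_mono order_refl) auto
      also have "\<dots> = real n * (ln rate + 1 + ln A' + ln (2 * real C + 1)) - real n * ln (real n)
         + A' * (real n / ln (real n)) * (ln 2 + ln (real n)) - real n * ln (real m)"
        by (simp add: algebra_simps)
      also have "\<dots> \<le> real n * (ln rate + 1 + ln A' + ln (2 * real C + 1)) - real n * ln (real n)
         + A' * (real n / ln (real n)) * (ln 2 + ln (real n))
         - real n * ((ln (real n) - ln (ln (real n))) / real e - ln 2)"
        using lnm by (intro diff_mono mult_left_mono order_refl) auto
      also have "\<dots> = - (1 + 1 / real e) * real n * ln (real n) + g n"
        unfolding g_def K_def by (simp add: algebra_simps diff_divide_distrib)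
      finally have "ln rhs \<le> - (1 + 1 / real e) * real n * ln (real n) + g n" .
      then have "rhs \<le> exp (- (1 + 1 / real e) * real n * ln (real n) + g n)"
        using rhs by (metis exp_le_cancel_iff exp_ln)
      then show ?case using bound[OF elim(3) m(1)] unfolding rhs_def D_def by linarith
    qed
  qed
  ultimately show ?thesis using e by (intro nlogn_leI) (auto intro: add_pos_nonneg)
qed

context poisson_balls
begin

lemma cover_prob_nlogn_le:
  assumes d: "CARD('n) \<ge> 2" and c: "AE \<omega> in M. R 1 \<omega> = c"
    and tri: "\<And>a b. nrm (a + b) \<le> nrm a + nrm b"
    and small: "\<And>e \<delta>. (\<And>j. \<bar>e $ j\<bar> \<le> \<delta>) \<Longrightarrow> nrm e \<le> real CARD('n) * \<delta>"
    and desc: "axis_descent nrm c B \<eta>" and \<eta>: "\<eta> > 0"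
  shows "nlogn_le (cover_prob M nrm \<xi> R N) (1 + 1 / (real CARD('n) - 1))"
proof -
  define C where "C = nat \<lceil>CARD('n) / \<eta>\<rceil>"
  have C: "CARD('n) / \<eta> \<le> real C" unfolding C_def by linarith
  have "nlogn_le (cover_prob M nrm \<xi> R N) (1 + 1 / real (CARD('n) - 1))"
  proof (rule nlogn_le_of_grid_bound[OF _ rate_pos])
    show "1 \<le> CARD('n) - 1" using d by simp
    show "1 \<le> CARD('n) * 2 * (B + 1)" using d by simp
    fix n m :: nat assume n: "n \<ge> 2" and m: "m \<ge> 1"
    have "cover_prob M nrm \<xi> R N n \<le> rate ^ n / fact n *
      (real ((CARD('n) * 2 * (B + 1) * (m + 1) ^ (CARD('n) - 1)) ^ n
         * ((m + 1) ^ (CARD('n) * 2 * (B + 1) * (m + 1) ^ (CARD('n) - 1)) * (2 * C + 1) ^ n))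
        * ((1 / real m) ^ CARD('n)) ^ n)"
    proof (rule cover_prob_le[OF n c, where A = "grid_cell m" and \<G> = "cell_assignments B C m"])
      show "measure lborel (unit_cube \<inter> grid_cell m b :: (real ^ 'n) set) \<le> (1 / real m) ^ CARD('n)" for b
        using m by (intro measure_grid_cell_le) auto
      show "real (card (cell_assignments B C m I :: (nat \<Rightarrow> 'n \<Rightarrow> nat) set)) \<le> real ((CARD('n) * 2 * (B + 1) * (m + 1) ^ (CARD('n) - 1)) ^ n
         * ((m + 1) ^ (CARD('n) * 2 * (B + 1) * (m + 1) ^ (CARD('n) - 1)) * (2 * C + 1) ^ n))"
        if "finite I" "card I = n" for I
        using card_cell_assignments_le[OF that(1), of B C m, where 'n = 'n] that(2)
        unfolding card_direction_cells of_nat_le_iff by simp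
      show "\<exists>g\<in>cell_assignments B C m I. \<forall>i\<in>I. x i \<in> grid_cell m (g i)"
        if "finite I" "\<And>i. i \<in> I \<Longrightarrow> x i \<in> unit_cube" "irredundant nrm x (\<lambda>_. c) I" for I x
        using that m C by (intro irredundant_cell_assignment[OF tri small desc \<eta>]) auto
    qed (auto intro: grid_cell_borel finite_cell_assignments)
    then show "cover_prob M nrm \<xi> R N n \<le> rate ^ n / fact n *
      (real ((CARD('n) * 2 * (B + 1) * (m + 1) ^ (CARD('n) - 1)) ^ n
         * ((m + 1) ^ (CARD('n) * 2 * (B + 1) * (m + 1) ^ (CARD('n) - 1)) * (2 * C + 1) ^ n))
        * ((1 / real m) ^ (CARD('n) - 1 + 1)) ^ n)"
      using d by simp
  qed
  then show ?thesis using d by (simp add: of_nat_diff)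
qed

end

section \<open>Descent directions of the two norms\<close>

text \<open>
  Pigeonhole. A vector that is far from the centre of the ball has a coordinate of size bounded
  below, and this coordinate provides the descent direction.
\<close>

lemma large_coordinate:
  fixes w :: "real ^ 'n"
  assumes "c / 2 < (\<Sum>i\<in>UNIV. \<bar>w $ i\<bar>)"
  shows "\<exists>k. c / (2 * real CARD('n)) \<le> \<bar>w $ k\<bar>"
proof (rule ccontr)
  assume "\<not> ?thesis"
  then have "(\<Sum>i\<in>UNIV. \<bar>w $ i\<bar>) \<le> (\<Sum>i\<in>(UNIV :: 'n set). c / (2 * real CARD('n)))"
    by (intro sum_mono) (simp add: not_le less_imp_le)
  then show False using assms by simp
qed

lemma l1_norm_triangle: "l1_norm (a + b) \<le> l1_norm a + l1_norm b"
  unfolding l1_norm_def by (simp add: sum.distrib[symmetric] sum_mono)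

lemma l1_norm_le: "(\<And>j. \<bar>e $ j\<bar> \<le> \<delta>) \<Longrightarrow> l1_norm (e :: real ^ 'n) \<le> real CARD('n) * \<delta>"
  unfolding l1_norm_def using sum_mono[of UNIV "\<lambda>j. \<bar>e $ j\<bar>" "\<lambda>_. \<delta>"] by simp

lemma norm_le_card:
  assumes "\<And>j. \<bar>e $ j\<bar> \<le> \<delta>"
  shows "norm (e :: real ^ 'n) \<le> real CARD('n) * \<delta>"
  using norm_le_l1_cart[of e] l1_norm_le[of e \<delta>] assms unfolding l1_norm_def by force

lemma sgn_times_abs_shift:
  fixes a t :: real
  assumes "0 \<le> t" "t \<le> \<bar>a\<bar>" "a \<noteq> 0"
  shows "\<bar>a - t * sgn a\<bar> = \<bar>a\<bar> - t"
  using assms by (auto simp: sgn_if abs_if split: if_splits)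

lemma sgn_mem: "a \<noteq> 0 \<Longrightarrow> sgn a \<in> {1, -1 :: real}"
  by (auto simp: sgn_if)

text \<open>
  Reducing a nonzero coordinate in absolute value by \<open>t\<close> reduces the norm by exactly \<open>t\<close>. Near the
  centre of the ball any direction will do, because there is room for the step.
\<close>

lemma axis_descent_l1:
  fixes c :: real
  assumes c: "c > 0" and B: "4 * real CARD('n) / c \<le> real B"
  shows "axis_descent (l1_norm :: real ^ 'n \<Rightarrow> real) c B 1"
  unfolding axis_descent_def
proof (intro allI impI)
  fix w :: "real ^ 'n" assume w: "l1_norm w \<le> c"
  have d: "real CARD('n) \<ge> 1" by (simp add: Suc_le_eq)
  have tB: "t * real CARD('n) \<le> c / 4" if "0 \<le> t" "t * real B \<le> 1" for t
  proof -
    have "t * (4 * real CARD('n) / c) \<le> 1" using mult_left_mono[OF B that(1)] that(2) by linarith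
    then show ?thesis using c by (simp add: field_simps)
  qed
  have t4: "t \<le> c / 4" if "0 \<le> t" "t * real B \<le> 1" for t
    using tB[OF that] mult_left_mono[OF d that(1)] by linarith
  show "\<exists>k. \<exists>s\<in>{1, -1}. \<forall>t. 0 \<le> t \<and> t * real B \<le> 1 \<longrightarrow>
     l1_norm (w - (t * s) *\<^sub>R axis k 1) \<le> c - 1 * t"
  proof (cases "l1_norm w \<le> c / 2")
    case True
    obtain k :: 'n where True by simp
    have "l1_norm (w - (t * 1) *\<^sub>R axis k 1) \<le> c - 1 * t" if t: "0 \<le> t \<and> t * real B \<le> 1" for t
    proof -
      have "l1_norm (- (t *\<^sub>R axis k 1) :: real ^ 'n) = t"
        unfolding l1_norm_def using t by (simp add: axis_def if_distrib if_distribR cong: if_cong)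
      then show ?thesis using l1_norm_triangle[of w "- (t *\<^sub>R axis k 1)"] True t4[of t] t by simp
    qed
    then show ?thesis by blast
  next
    case False
    then obtain k where k: "c / (2 * real CARD('n)) \<le> \<bar>w $ k\<bar>"
      using large_coordinate[of c w] unfolding l1_norm_def by auto
    moreover have "c / (2 * real CARD('n)) > 0" using c by simp
    ultimately have nz: "w $ k \<noteq> 0" by auto
    have "l1_norm (w - (t * sgn (w $ k)) *\<^sub>R axis k 1) \<le> c - 1 * t" if t: "0 \<le> t \<and> t * real B \<le> 1" for t
    proof -
      have "t \<le> c / (2 * real CARD('n))" using tB[of t] t c d by (simp add: field_simps)
      then have s: "\<bar>w $ k - t * sgn (w $ k)\<bar> = \<bar>w $ k\<bar> - t"
        using t k nz by (intro sgn_times_abs_shift) auto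
      have "l1_norm (w - (t * sgn (w $ k)) *\<^sub>R axis k 1) = \<bar>w $ k - t * sgn (w $ k)\<bar> + (\<Sum>i\<in>UNIV - {k}. \<bar>w $ i\<bar>)"
        unfolding l1_norm_def by (subst sum.remove[of _ k]) (auto simp: axis_def intro!: sum.cong)
      moreover have "l1_norm w = \<bar>w $ k\<bar> + (\<Sum>i\<in>UNIV - {k}. \<bar>w $ i\<bar>)"
        unfolding l1_norm_def by (subst sum.remove[of _ k]) auto
      ultimately show ?thesis using s w by simp
    qed
    then show ?thesis using sgn_mem[OF nz] by blast
  qed
qed

lemma norm_sq_remove: "(norm (w :: real ^ 'n))\<^sup>2 = (w $ k)\<^sup>2 + (\<Sum>i\<in>UNIV - {k}. (w $ i)\<^sup>2)"
proof -
  have "(norm w)\<^sup>2 = (\<Sum>i\<in>UNIV. (w $ i)\<^sup>2)"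
    unfolding norm_vec_def L2_set_def by (simp add: sum_nonneg)
  then show ?thesis by (simp add: sum.remove[of UNIV k])
qed

text \<open>
  If \<open>\<bar>w $ k\<bar> \<ge> c / (2 d) \<ge> t\<close>, then reducing this coordinate in absolute value by \<open>t\<close> changes the squared norm by
  \<open>- t * (2 * \<bar>w $ k\<bar> - t) \<le> - t * c / (2 d)\<close>. Comparing with \<open>(c - \<eta> * t)\<^sup>2 \<ge> c\<^sup>2 - 2 * c * \<eta> * t\<close> gives the
  rate \<open>\<eta> = 1 / (4 d)\<close>.
\<close>

lemma axis_descent_l2:
  fixes c :: real
  assumes c: "c > 0" and B: "4 * real CARD('n) / c \<le> real B"
  shows "axis_descent (norm :: real ^ 'n \<Rightarrow> real) c B (1 / (4 * real CARD('n)))"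
  unfolding axis_descent_def
proof (intro allI impI)
  fix w :: "real ^ 'n" assume w: "norm w \<le> c"
  define d where "d = real CARD('n)"
  have d: "d \<ge> 1" unfolding d_def by (simp add: Suc_le_eq)
  have tB: "t * d \<le> c / 4" if "0 \<le> t" "t * real B \<le> 1" for t
  proof -
    have "t * (4 * d / c) \<le> 1" using mult_left_mono[OF B that(1)] that(2) unfolding d_def by linarith
    then show ?thesis using c by (simp add: field_simps)
  qed
  have t4: "t \<le> c / 4" if "0 \<le> t" "t * real B \<le> 1" for t
    using tB[OF that] mult_left_mono[OF d that(1)] by linarith
  have eta: "1 / (4 * d) * t \<le> t" if "0 \<le> t" for t
    using that d mult_right_mono[of "1 / (4 * d)" 1 t] by simp
  show "\<exists>k. \<exists>s\<in>{1, -1}. \<forall>t. 0 \<le> t \<and> t * real B \<le> 1 \<longrightarrow>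
     norm (w - (t * s) *\<^sub>R axis k 1) \<le> c - 1 / (4 * real CARD('n)) * t"
  proof (cases "norm w \<le> c / 2")
    case True
    obtain k :: 'n where True by simp
    have "norm (w - (t * 1) *\<^sub>R axis k 1) \<le> c - 1 / (4 * d) * t" if t: "0 \<le> t \<and> t * real B \<le> 1" for t
    proof -
      have "norm (w - (t * 1) *\<^sub>R axis k 1) \<le> norm w + norm ((t * 1) *\<^sub>R axis k (1::real))"
        by (rule norm_triangle_ineq4)
      also have "norm ((t * 1) *\<^sub>R axis k (1::real)) = t" using t by (simp add: norm_axis_1)
      finally show ?thesis using True t4[of t] eta[of t] t by linarith
    qed
    then show ?thesis unfolding d_def by blast
  next
    case False
    then obtain k where k: "c / (2 * d) \<le> \<bar>w $ k\<bar>"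
      using large_coordinate[of c w] norm_le_l1_cart[of w] unfolding d_def by force
    moreover have "c / (2 * d) > 0" using c d by simp
    ultimately have nz: "w $ k \<noteq> 0" by auto
    have "norm (w - (t * sgn (w $ k)) *\<^sub>R axis k 1) \<le> c - 1 / (4 * d) * t" if t: "0 \<le> t \<and> t * real B \<le> 1" for t
    proof (rule power2_le_imp_le)
      have td: "t \<le> c / (2 * d)" using tB[of t] t c d by (simp add: field_simps)
      then have s: "\<bar>w $ k - t * sgn (w $ k)\<bar> = \<bar>w $ k\<bar> - t"
        using t k nz by (intro sgn_times_abs_shift) auto
      have "(norm (w - (t * sgn (w $ k)) *\<^sub>R axis k 1))\<^sup>2
         = (w $ k - t * sgn (w $ k))\<^sup>2 + (\<Sum>i\<in>UNIV - {k}. (w $ i)\<^sup>2)"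
        by (subst norm_sq_remove[of _ k]) (auto simp: axis_def intro!: sum.cong)
      also have "(w $ k - t * sgn (w $ k))\<^sup>2 = (\<bar>w $ k\<bar> - t)\<^sup>2"
        using s by (metis power2_abs)
      also have "(\<bar>w $ k\<bar> - t)\<^sup>2 + (\<Sum>i\<in>UNIV - {k}. (w $ i)\<^sup>2) = (norm w)\<^sup>2 - t * (2 * \<bar>w $ k\<bar> - t)"
        by (subst norm_sq_remove[of w k]) (simp add: power2_eq_square algebra_simps)
      also have "\<dots> \<le> c\<^sup>2 - t * (c / (2 * d))"
        using w t td k by (intro diff_mono power_mono mult_left_mono) auto
      also have "\<dots> \<le> (c - 1 / (4 * d) * t)\<^sup>2"
        using d by (simp add: power2_eq_square field_simps)
      finally show "(norm (w - (t * sgn (w $ k)) *\<^sub>R axis k 1))\<^sup>2 \<le> (c - 1 / (4 * d) * t)\<^sup>2" .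
      show "0 \<le> c - 1 / (4 * d) * t" using eta[of t] t4[of t] t c by linarith
    qed
    then show ?thesis using sgn_mem[OF nz] unfolding d_def by blast
  qed
qed

section \<open>The lower bound from boxes along a hyperplane\<close>

text \<open>
  The positions of an \<open>m\<close>-grid on a hyperplane that is a graph over the coordinates other than \<open>k\<close>. The
  value \<open>0\<close> at \<open>k\<close> is a placeholder.
\<close>

definition layer_index :: "'n \<Rightarrow> nat \<Rightarrow> ('n::finite \<Rightarrow> nat) set" where
  "layer_index k m = PiE UNIV (\<lambda>j. if j = k then {0} else {..<m})"

lemma card_layer_index: "card (layer_index (k :: 'n::finite) m) = m ^ (CARD('n) - 1)"
proof -
  have "card (layer_index k m) = (\<Prod>j\<in>UNIV. card (if j = k then {0} else {..<m}))"
    unfolding layer_index_def by (simp add: card_PiE)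
  also have "\<dots> = (\<Prod>j\<in>UNIV - {k}. card (if j = k then {0} else {..<m}))"
    by (subst prod.remove[of _ k]) auto
  also have "\<dots> = (\<Prod>j\<in>UNIV - {k}. m)" by (intro prod.cong) auto
  finally show ?thesis by (simp add: card_Diff_singleton)
qed

lemma layer_indexD:
  assumes "p \<in> layer_index k m"
  shows "p k = 0" "j \<noteq> k \<Longrightarrow> p j < m"
  using PiE_mem[OF assms[unfolded layer_index_def], of k]
    PiE_mem[OF assms[unfolded layer_index_def], of j] by auto

lemma layer_index_differ:
  assumes "p \<in> layer_index k m" "q \<in> layer_index k m" "p \<noteq> q"
  shows "\<exists>j. j \<noteq> k \<and> p j \<noteq> q j"
  using assms layer_indexD(1) by (metis ext)

lemma measure_box:
  fixes z r :: "real ^ 'n"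
  assumes "\<And>j. 0 \<le> r $ j"
  shows "measure lborel (cbox (z - r) (z + r)) = (\<Prod>j\<in>UNIV. 2 * r $ j)"
proof -
  have "z $ j - r $ j \<le> z $ j + r $ j" for j using assms[of j] by linarith
  then have "cbox (z - r) (z + r) \<noteq> {}" by (simp add: interval_ne_empty_cart)
  then show ?thesis by (subst content_cbox_cart) (auto intro!: prod.cong)
qed

lemma mem_box_iff:
  fixes z r x :: "real ^ 'n"
  shows "x \<in> cbox (z - r) (z + r) \<longleftrightarrow> (\<forall>j. \<bar>x $ j - z $ j\<bar> \<le> r $ j)"
  unfolding mem_box_cart abs_le_iff by (auto simp: algebra_simps)

text \<open>
  The boxes with centres \<open>z p\<close> and half side lengths \<open>r\<close> lie in the cube, and \<open>y p\<close> is a common witness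
  for all centres in the box of \<open>p\<close>, however the other centres are placed in their boxes.
\<close>

definition layer_config ::
  "(real ^ 'n \<Rightarrow> real) \<Rightarrow> real \<Rightarrow> 'n \<Rightarrow> nat \<Rightarrow> (('n \<Rightarrow> nat) \<Rightarrow> real ^ 'n) \<Rightarrow> real ^ 'n
    \<Rightarrow> (('n \<Rightarrow> nat) \<Rightarrow> real ^ 'n) \<Rightarrow> bool" where
  "layer_config nrm c k m z r y \<longleftrightarrow>
     (\<forall>p\<in>layer_index k m. \<forall>j. 0 \<le> z p $ j - r $ j \<and> z p $ j + r $ j \<le> 1) \<and>
     (\<forall>p\<in>layer_index k m. y p \<in> unit_cube) \<and>
     (\<forall>p\<in>layer_index k m. \<forall>x. (\<forall>j. \<bar>x $ j - z p $ j\<bar> \<le> r $ j) \<longrightarrow> nrm (y p - x) \<le> c) \<and>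
     (\<forall>p\<in>layer_index k m. \<forall>q\<in>layer_index k m. \<forall>x. q \<noteq> p \<and> (\<forall>j. \<bar>x $ j - z q $ j\<bar> \<le> r $ j) \<longrightarrow>
        c < nrm (y p - x))"

context poisson_balls
begin

text \<open>
  Take the smallest \<open>m\<close> with \<open>m \<ge> n\<^bsup>1/(d-1)\<^esup>\<close>, so that the \<open>m\<^bsup>d-1\<^esup>\<close> grid positions accommodate \<open>n\<close> boxes; then
  \<open>1 / m \<ge> n\<^bsup>-1/(d-1)\<^esup> / 2\<close>, and a box volume of order \<open>m\<^bsup>-b\<^esup>\<close> becomes one of order \<open>n\<^bsup>-b/(d-1)\<^esup>\<close>.
\<close>

lemma cover_prob_nlogn_ge:
  fixes k :: 'n and b :: nat and C :: real
  assumes d: "CARD('n) \<ge> 2" and c: "AE \<omega> in M. R 1 \<omega> = c"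
    and cont: "continuous_on UNIV nrm" and b: "b > 0" and C: "C > 0"
    and config: "\<forall>\<^sub>F m in sequentially. \<exists>z r y. layer_config nrm c k m z r y \<and>
       (\<forall>j. 0 \<le> r $ j) \<and> C * (1 / real m) ^ b \<le> (\<Prod>j\<in>UNIV. 2 * r $ j)"
  shows "nlogn_ge (cover_prob M nrm \<xi> R N) (real b / (real CARD('n) - 1))"
proof -
  define e where "e = CARD('n) - 1"
  have e: "e \<ge> 1" "real CARD('n) - 1 = real e" using d unfolding e_def by auto
  obtain m0 where config: "\<exists>z r y. layer_config nrm c k m z r y \<and>
       (\<forall>j. 0 \<le> r $ j) \<and> C * (1 / real m) ^ b \<le> (\<Prod>j\<in>UNIV. 2 * r $ j)" if "m \<ge> m0" for m
    using config unfolding eventually_sequentially by blast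
  define C' where "C' = C * (1 / 2) ^ b"
  have C': "C' > 0" unfolding C'_def using C by simp
  define K where "K = ln rate + ln C'"
  have "nlogn_ge (cover_prob M nrm \<xi> R N) (real b / real e)"
  proof (rule nlogn_geI)
    show "real b / real e > 0" using b e by simp
    show "(\<lambda>n. (real n * K - rate) / (real n * ln (real n))) \<longlonglongrightarrow> 0"
      by real_asymp
    show "\<forall>\<^sub>F n in sequentially. exp (- (real b / real e) * real n * ln (real n) + (real n * K - rate))
       \<le> cover_prob M nrm \<xi> R N n"
      using eventually_gt_at_top[of "m0 ^ e"] eventually_ge_at_top[of 1]
    proof eventually_elim
      case (elim n)
      define m where "m = nat \<lceil>real n powr (1 / real e)\<rceil>"
      have p1: "real n powr (1 / real e) \<ge> 1" using elim by (simp add: ge_one_powr_ge_zero)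
      have m: "real n powr (1 / real e) \<le> real m" "real m \<le> 2 * real n powr (1 / real e)" "m \<ge> 1"
        using p1 unfolding m_def by linarith+
      have ne: "(real n powr (1 / real e)) ^ e = real n"
        using e elim by (simp add: powr_power powr_powr)
      have "real n \<le> real m ^ e"
        using m power_mono[of "real n powr (1 / real e)" "real m" e] by (simp add: ne)
      then have nm: "n \<le> m ^ e" by (metis of_nat_le_iff of_nat_power)
      have "m \<ge> m0"
      proof (rule ccontr)
        assume "\<not> m \<ge> m0"
        then have "m ^ e \<le> m0 ^ e" by (intro power_mono) auto
        then show False using nm elim by linarith
      qed
      then obtain z r y where conf: "layer_config nrm c k m z r y" "\<And>j. 0 \<le> r $ j"
        "C * (1 / real m) ^ b \<le> (\<Prod>j\<in>UNIV. 2 * r $ j)" using config by blast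
      note inside = conf(1)[unfolded layer_config_def, THEN conjunct1, rule_format]
      note witness = conf(1)[unfolded layer_config_def, THEN conjunct2, THEN conjunct1, rule_format]
      note near = conf(1)[unfolded layer_config_def, THEN conjunct2, THEN conjunct2, THEN conjunct1, rule_format]
      note far = conf(1)[unfolded layer_config_def, THEN conjunct2, THEN conjunct2, THEN conjunct2, rule_format]
      have "\<exists>P. P ` {1..n} \<subseteq> layer_index k m \<and> inj_on P {1..n}"
      proof (rule card_le_inj)
        show "finite (layer_index k m)" unfolding layer_index_def by (intro finite_PiE) auto
        show "card {1..n} \<le> card (layer_index k m)"
          using nm unfolding card_layer_index e_def by simp
      qed simp
      then obtain P where P: "\<And>i. i \<in> {1..n} \<Longrightarrow> P i \<in> layer_index k m" "inj_on P {1..n}"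
        by blast
      define v where "v = C' * real n powr (- (real b / real e))"
      have "exp (- rate) * (rate * v) ^ n \<le> cover_prob M nrm \<xi> R N n"
      proof (rule cover_prob_ge[OF elim(2) c cont, where Q = "\<lambda>i. cbox (z (P i) - r) (z (P i) + r)"
            and y = "\<lambda>i. y (P i)"])
        fix i assume i: "i \<in> {1..n}"
        note Pi = P(1)[OF i]
        show "cbox (z (P i) - r) (z (P i) + r) \<in> sets borel" by simp
        show "cbox (z (P i) - r) (z (P i) + r) \<subseteq> unit_cube"
        proof
          fix x assume x: "x \<in> cbox (z (P i) - r) (z (P i) + r)"
          have "0 \<le> x $ j \<and> x $ j \<le> 1" for j
          proof -
            have "0 \<le> z (P i) $ j - r $ j \<and> z (P i) $ j + r $ j \<le> 1"
              using inside[OF Pi, of j] .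
            moreover have "\<bar>x $ j - z (P i) $ j\<bar> \<le> r $ j" using x unfolding mem_box_iff by blast
            ultimately show ?thesis by linarith
          qed
          then show "x \<in> unit_cube" by (simp add: mem_box_cart)
        qed
        show "v \<le> measure lborel (cbox (z (P i) - r) (z (P i) + r))"
        proof -
          have "(real n powr (1 / real e)) powr real b = real n powr (real b / real e)"
            by (simp add: powr_powr)
          then have "(real n powr (1 / real e)) ^ b = real n powr (real b / real e)"
            using powr_realpow[of "real n powr (1 / real e)" b] p1 by linarith
          then have "real n powr (- (real b / real e)) = (1 / real n powr (1 / real e)) ^ b"
            by (simp add: powr_minus_divide power_one_over)
          also have "\<dots> \<le> (2 * (1 / real m)) ^ b"
          proof (rule power_mono)
            have "real n powr (1 / real e) > 0" using p1 by linarith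
            then show "1 / real n powr (1 / real e) \<le> 2 * (1 / real m)"
              using m by (simp add: field_simps)
          qed simp
          finally have "v \<le> C' * (2 * (1 / real m)) ^ b"
            unfolding v_def using C' by (intro mult_left_mono) auto
          also have "\<dots> = C * (1 / real m) ^ b"
            unfolding C'_def by (simp add: power_mult_distrib power_divide)
          also have "\<dots> \<le> (\<Prod>j\<in>UNIV. 2 * r $ j)" by (rule conf(3))
          finally show ?thesis using conf(2) by (simp add: measure_box)
        qed
        show "y (P i) \<in> unit_cube"
          by (rule witness[OF Pi])
        show "nrm (y (P i) - x) \<le> c" if "x \<in> cbox (z (P i) - r) (z (P i) + r)" for x
          using near[OF Pi] that unfolding mem_box_iff by simp
        show "c < nrm (y (P i) - x)" if j: "j \<in> {1..n}" "j \<noteq> i"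
            and x: "x \<in> cbox (z (P j) - r) (z (P j) + r)" for j x
        proof -
          have "P j \<noteq> P i" using inj_onD[OF P(2) _ j(1) i] j(2) by blast
          then show ?thesis
            using far[OF Pi P(1)[OF j(1)]] x unfolding mem_box_iff by simp
        qed
      qed (use C' in \<open>simp add: v_def\<close>)
      moreover have "exp (- (real b / real e) * real n * ln (real n) + (real n * K - rate))
          = exp (- rate) * (rate * v) ^ n"
      proof -
        have v: "v > 0" unfolding v_def using C' elim by simp
        have lnv: "ln (rate * v) = K - (real b / real e) * ln (real n)"
          unfolding K_def using rate_pos v C' elim by (simp add: ln_mult v_def ln_powr)
        have "(rate * v) ^ n = exp (real n * ln (rate * v))"
          using rate_pos v by (subst exp_of_nat_mult) simp
        then show ?thesis unfolding lnv by (simp add: exp_add[symmetric] algebra_simps)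
      qed
      ultimately show ?case by simp
    qed
  qed
  then show ?thesis using e by simp
qed

end

section \<open>Configurations for the three norms\<close>

lemma eventually_inverse_le:
  assumes "\<delta> > 0"
  shows "\<forall>\<^sub>F m in sequentially. 1 / real m \<le> \<delta>"
  using assms by real_asymp

text \<open>
  Midpoints of the cells of an \<open>m\<close>-grid on the hyperplane at height \<open>h\<close> in coordinate \<open>k\<close>.
\<close>

definition layer_centre :: "real \<Rightarrow> 'n \<Rightarrow> nat \<Rightarrow> ('n::finite \<Rightarrow> nat) \<Rightarrow> real ^ 'n" where
  "layer_centre h k m p = (\<chi> j. if j = k then h else (2 * real (p j) + 1) / (2 * real m))"

lemma layer_centre_bounds:
  assumes "p \<in> layer_index k m" "j \<noteq> k"
  shows "1 / (2 * real m) \<le> layer_centre h k m p $ j" "layer_centre h k m p $ j \<le> 1 - 1 / (2 * real m)"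
proof -
  have p: "real (p j) + 1 \<le> real m" using layer_indexD(2)[OF assms] by linarith
  then have m: "real m > 0" by linarith
  show "1 / (2 * real m) \<le> layer_centre h k m p $ j"
    using assms(2) m by (simp add: layer_centre_def field_simps)
  have "(2 * real (p j) + 1) / (2 * real m) + 1 / (2 * real m) \<le> 1"
    using p m by (simp add: add_divide_distrib[symmetric])
  then show "layer_centre h k m p $ j \<le> 1 - 1 / (2 * real m)"
    using assms(2) by (simp add: layer_centre_def)
qed

lemma layer_centre_separated:
  assumes "p \<in> layer_index k m" "j \<noteq> k" "p j \<noteq> q j"
  shows "1 / real m \<le> \<bar>layer_centre h k m p $ j - layer_centre h k m q $ j\<bar>"
proof -
  have m: "real m > 0" using layer_indexD(2)[OF assms(1,2)] by simp
  have "layer_centre h k m p $ j - layer_centre h k m q $ j = (real (p j) - real (q j)) / real m"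
    using assms(2) m by (simp add: layer_centre_def field_simps)
  moreover have "1 \<le> \<bar>real (p j) - real (q j)\<bar>" using assms(3) by linarith
  ultimately show ?thesis using m by (simp add: abs_divide divide_right_mono)
qed

text \<open>
  The witness of \<open>p\<close> is near the tip \<open>z p + c * e\<^sub>k\<close> of the cross-polytope, and another centre of the layer is
  farther from it by at least the lateral distance \<open>1 / m\<close>. Boxes of half side \<open>\<rho>\<close> of order \<open>1 / m\<close> are therefore
  admissible. The witness is lowered by \<open>d * \<rho>\<close> to stay in the ball when the centre moves in its
  box; with \<open>(d + 3) * \<rho> = 1 / m\<close>, the lateral distance outweighs this and the motion of the other centre, which together cost \<open>(d + 2) * \<rho>\<close>.
  The height \<open>h = (1 - c) / 2\<close> leaves room for a ball radius and a margin on both sides.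
\<close>

lemma layer_config_l1:
  fixes c :: real and k :: "'n::finite"
  assumes c: "0 < c" "c < 1"
  shows "\<forall>\<^sub>F m in sequentially. \<exists>z r y. layer_config (l1_norm :: real ^ 'n \<Rightarrow> real) c k m z r y \<and>
       (\<forall>j. 0 \<le> r $ j) \<and> (2 / (real CARD('n) + 3)) ^ CARD('n) * (1 / real m) ^ CARD('n) \<le> (\<Prod>j\<in>UNIV. 2 * r $ j)"
proof -
  define d where "d = real CARD('n)"
  have d: "d \<ge> 1" unfolding d_def by (simp add: Suc_le_eq)
  have "\<forall>\<^sub>F m in sequentially. 1 / real m \<le> min c ((1 - c) / 2)"
    using c by (intro eventually_inverse_le) auto
  then show ?thesis using eventually_gt_at_top[of 0]
  proof eventually_elim
    case (elim m)
    define \<rho> where "\<rho> = 1 / ((d + 3) * real m)"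
    define h where "h = (1 - c) / 2"
    have m: "real m > 0" using elim by simp
    have \<rho>: "\<rho> > 0" using m d unfolding \<rho>_def by simp
    have \<rho>m: "(d + 3) * \<rho> = 1 / real m" using m d unfolding \<rho>_def by simp
    have d\<rho>: "d * \<rho> \<ge> \<rho>" using d \<rho> by simp
    have \<rho>le: "d * \<rho> + 3 * \<rho> \<le> c" "d * \<rho> + 3 * \<rho> \<le> h" "d * \<rho> + 3 * \<rho> = 1 / real m"
      using elim \<rho>m unfolding h_def by (simp_all add: algebra_simps)
    have hc: "0 \<le> h" "h + c \<le> 1" using c unfolding h_def by (simp_all add: field_simps)
    define z where "z = layer_centre h k m"
    define r where "r = (\<chi> j :: 'n. \<rho>)"
    define y where "y p = z p + (c - d * \<rho>) *\<^sub>R axis k 1" for p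
    have zk: "z p $ k = h" for p unfolding z_def layer_centre_def by simp
    have yk: "y p $ k = h + (c - d * \<rho>)" for p unfolding y_def zk vector_add_component by (simp add: axis_def)
    have yj: "y p $ j = z p $ j" if "j \<noteq> k" for p j using that unfolding y_def by (simp add: axis_def)
    have zj: "\<rho> \<le> z p $ j" "z p $ j \<le> 1 - \<rho>" if "p \<in> layer_index k m" for p j
    proof -
      have "1 / (2 * real m) = 1 / real m / 2" by simp
      then have "\<rho> \<le> 1 / (2 * real m)" using \<rho>le(3) d\<rho> \<rho> by linarith
      moreover have "\<rho> \<le> h" using \<rho>le d\<rho> \<rho> by linarith
      moreover have "h \<le> 1 - h" using c unfolding h_def by (simp add: field_simps)
      ultimately show "\<rho> \<le> z p $ j" "z p $ j \<le> 1 - \<rho>"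
        using layer_centre_bounds[OF that, of j h] zk[of p] unfolding z_def[symmetric]
        by (cases "j = k"; simp; linarith)+
    qed
    have "layer_config l1_norm c k m z r y"
      unfolding layer_config_def
    proof (intro conjI ballI allI impI)
      fix p assume p: "p \<in> layer_index k m"
      show "0 \<le> z p $ j - r $ j" "z p $ j + r $ j \<le> 1" for j
        using zj[OF p, of j] unfolding r_def by simp_all
      have "0 \<le> y p $ j \<and> y p $ j \<le> 1" for j
      proof (cases "j = k")
        case True
        have "y p $ j = h + (c - d * \<rho>)" using yk[of p] True by simp
        then show ?thesis using \<rho>le d\<rho> \<rho> hc by linarith
      next
        case False
        then show ?thesis using zj[OF p, of j] yj[OF False, of p] \<rho> by linarith
      qed
      then show "y p \<in> unit_cube" by (simp add: mem_box_cart)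
      show "l1_norm (y p - x) \<le> c" if x: "\<forall>j. \<bar>x $ j - z p $ j\<bar> \<le> r $ j" for x
      proof -
        have xj: "\<bar>x $ j - z p $ j\<bar> \<le> \<rho>" for j using x unfolding r_def by simp
        have "l1_norm (y p - x) = \<bar>y p $ k - x $ k\<bar> + (\<Sum>j\<in>UNIV - {k}. \<bar>y p $ j - x $ j\<bar>)"
          unfolding l1_norm_def by (subst sum.remove[of _ k]) auto
        also have "\<dots> \<le> (c - d * \<rho> + \<rho>) + (\<Sum>j\<in>UNIV - {k}. \<rho>)"
        proof (intro add_mono sum_mono)
          show "\<bar>y p $ k - x $ k\<bar> \<le> c - d * \<rho> + \<rho>"
            using xj[of k] \<rho>le \<rho> unfolding yk zk by linarith
          show "\<bar>y p $ j - x $ j\<bar> \<le> \<rho>" if "j \<in> UNIV - {k}" for j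
            using xj[of j] yj[of j p] that by (simp add: abs_minus_commute)
        qed
        also have "\<dots> = c"
          using d unfolding d_def by (simp add: card_Diff_singleton of_nat_diff Suc_le_eq algebra_simps)
        finally show ?thesis .
      qed
      show "c < l1_norm (y p - x)"
        if q: "q \<in> layer_index k m" and x: "q \<noteq> p \<and> (\<forall>j. \<bar>x $ j - z q $ j\<bar> \<le> r $ j)" for q x
      proof -
        have xj: "\<bar>x $ j - z q $ j\<bar> \<le> \<rho>" for j using x unfolding r_def by simp
        obtain j where j: "j \<noteq> k" "p j \<noteq> q j" using layer_index_differ[OF p q] x by metis
        have "c - d * \<rho> - \<rho> \<le> \<bar>y p $ k - x $ k\<bar>" using xj[of k] unfolding yk zk by linarith
        moreover have "1 / real m - \<rho> \<le> \<bar>y p $ j - x $ j\<bar>"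
          using layer_centre_separated[where p = p and q = q and j = j and h = h, OF p j] xj[of j] yj[OF j(1), of p] unfolding z_def by linarith
        moreover have "\<bar>y p $ k - x $ k\<bar> + \<bar>y p $ j - x $ j\<bar> \<le> l1_norm (y p - x)"
          unfolding l1_norm_def using j(1)
          by (subst sum.remove[of _ k]) (auto intro!: member_le_sum)
        ultimately show ?thesis using \<rho>le(3) \<rho> by linarith
      qed
    qed
    moreover have "(2 / (d + 3)) ^ CARD('n) * (1 / real m) ^ CARD('n) \<le> (\<Prod>j\<in>UNIV. 2 * r $ j)"
      unfolding r_def \<rho>_def by (simp add: power_mult_distrib[symmetric])
    ultimately show ?case using \<rho> unfolding d_def
      by (intro exI[of _ z] exI[of _ r] exI[of _ y]) (auto simp: r_def)
  qed
qed

text \<open>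
  By Pythagoras the distance between the witness and another centre of the layer exceeds \<open>c\<close> only by
  the order of \<open>1 / m\<^sup>2\<close>. Hence the boxes are flat: half side \<open>\<rho>\<close> of order \<open>1 / m\<close> in the layer, but
  \<open>\<tau> = d * \<rho>\<^sup>2 / c\<close> across it. The value of \<open>\<tau>\<close> is such that lowering the witness by \<open>2 * \<tau>\<close> compensates for the lateral motion
  of its own centre, which adds at most \<open>(d - 1) * \<rho>\<^sup>2\<close> to the squared distance. This loses at most \<open>6 * c * \<tau> = 6 * d * \<rho>\<^sup>2\<close>
  in the squared distance from another centre, less than the gain \<open>(5 * d * \<rho>)\<^sup>2\<close> from a lateral distance \<open>1 / m - \<rho>\<close>, where
  \<open>1 / m = 6 * d * \<rho>\<close>.
\<close>

lemma layer_config_l2: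
  fixes c :: real and k :: "'n::finite"
  assumes c: "0 < c" "c < 1"
  shows "\<exists>C>0. \<forall>\<^sub>F m in sequentially. \<exists>z r y. layer_config (norm :: real ^ 'n \<Rightarrow> real) c k m z r y \<and>
       (\<forall>j. 0 \<le> r $ j) \<and> C * (1 / real m) ^ (CARD('n) + 1) \<le> (\<Prod>j\<in>UNIV. 2 * r $ j)"
proof -
  define d where "d = real CARD('n)"
  have d: "d \<ge> 1" unfolding d_def by (simp add: Suc_le_eq)
  define C where "C = 2 * (1 / (36 * d * c)) * (2 / (6 * d)) ^ (CARD('n) - 1)"
  have "C > 0" unfolding C_def using d c by simp
  moreover have "\<forall>\<^sub>F m in sequentially. \<exists>z r y. layer_config (norm :: real ^ 'n \<Rightarrow> real) c k m z r y \<and>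
       (\<forall>j. 0 \<le> r $ j) \<and> C * (1 / real m) ^ (CARD('n) + 1) \<le> (\<Prod>j\<in>UNIV. 2 * r $ j)"
  proof -
    (* Makes 3 * \<tau> smaller than the radius and the height of the layer. *)
    have "\<forall>\<^sub>F m in sequentially. 1 / real m \<le> min 1 (c * min c ((1 - c) / 2))"
      using c by (intro eventually_inverse_le) auto
    then show ?thesis using eventually_gt_at_top[of 0]
    proof eventually_elim
      case (elim m)
      define \<rho> where "\<rho> = 1 / (6 * d * real m)"
      define \<tau> where "\<tau> = d * \<rho>\<^sup>2 / c"
      define h where "h = (1 - c) / 2"
      have m: "real m > 0" using elim by simp
      have \<rho>: "\<rho> > 0" using m d unfolding \<rho>_def by simp
      have \<rho>m: "6 * (d * \<rho>) = 1 / real m" using m d unfolding \<rho>_def by simp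
      have d\<rho>: "d * \<rho> \<ge> \<rho>" using d \<rho> by simp
      have \<tau>: "\<tau> > 0" using d \<rho> c unfolding \<tau>_def by simp
      have c\<tau>: "c * \<tau> = d * \<rho>\<^sup>2" using c unfolding \<tau>_def by simp
      have \<tau>le: "3 * \<tau> \<le> c" "3 * \<tau> \<le> h"
      proof -
        have "\<rho> \<le> 1" using \<rho>m d\<rho> elim \<rho> by linarith
        then have "d * \<rho> * \<rho> \<le> d * \<rho> * 1" using d \<rho> by (intro mult_left_mono) auto
        then have "6 * (c * \<tau>) \<le> 1 / real m" using \<rho>m unfolding c\<tau> power2_eq_square by (simp add: mult.assoc)
        then have "6 * (c * \<tau>) \<le> c * min c h" using elim unfolding h_def by simp
        then have "c * (6 * \<tau>) \<le> c * min c h" by (simp add: mult.left_commute)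
        then have "6 * \<tau> \<le> min c h" using c by simp
        then show "3 * \<tau> \<le> c" "3 * \<tau> \<le> h" using \<tau> by linarith+
      qed
      define z where "z = layer_centre h k m"
      define r where "r = (\<chi> j. if j = k then \<tau> else \<rho>)"
      define y where "y p = z p + (c - 2 * \<tau>) *\<^sub>R axis k 1" for p
      have zk: "z p $ k = h" for p unfolding z_def layer_centre_def by simp
      have rk: "r $ k = \<tau>" unfolding r_def by simp
      have rj: "r $ j = \<rho>" if "j \<noteq> k" for j using that unfolding r_def by simp
      have yk: "y p $ k = h + (c - 2 * \<tau>)" for p unfolding y_def vector_add_component zk by (simp add: axis_def)
      have yj: "y p $ j = z p $ j" if "j \<noteq> k" for p j using that unfolding y_def by (simp add: axis_def)
      have zj: "\<rho> \<le> z p $ j" "z p $ j \<le> 1 - \<rho>" if "p \<in> layer_index k m" "j \<noteq> k" for p j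
      proof -
        have "1 / (2 * real m) = 1 / real m / 2" by simp
        then have "\<rho> \<le> 1 / (2 * real m)" using \<rho>m d\<rho> \<rho> by linarith
        then show "\<rho> \<le> z p $ j" "z p $ j \<le> 1 - \<rho>"
          using layer_centre_bounds[OF that, of h] unfolding z_def by linarith+
      qed
      have "layer_config norm c k m z r y"
        unfolding layer_config_def
      proof (intro conjI ballI allI impI)
        fix p assume p: "p \<in> layer_index k m"
        show "0 \<le> z p $ j - r $ j" "z p $ j + r $ j \<le> 1" for j
          using zj[OF p, of j] zk[of p] rk rj[of j] \<tau>le \<tau> c
          by (cases "j = k"; simp add: h_def)+
        have "0 \<le> y p $ j \<and> y p $ j \<le> 1" for j
          using zj[OF p, of j] yj[of j p] yk[of p] \<tau>le \<tau> \<rho> c unfolding h_def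
          by (cases "j = k") (auto simp: field_simps)
        then show "y p \<in> unit_cube" by (simp add: mem_box_cart)
        show "norm (y p - x) \<le> c" if x: "\<forall>j. \<bar>x $ j - z p $ j\<bar> \<le> r $ j" for x
        proof (rule power2_le_imp_le)
          have "(norm (y p - x))\<^sup>2 = (y p $ k - x $ k)\<^sup>2 + (\<Sum>j\<in>UNIV - {k}. (y p $ j - x $ j)\<^sup>2)"
            by (subst norm_sq_remove[of _ k]) simp
          also have "\<dots> \<le> (c - \<tau>)\<^sup>2 + (\<Sum>j\<in>UNIV - {k}. \<rho>\<^sup>2)"
          proof (intro add_mono sum_mono)
            have "\<bar>y p $ k - x $ k\<bar> \<le> c - \<tau>"
              using x[rule_format, of k] \<tau>le \<tau> unfolding yk zk rk by linarith
            then show "(y p $ k - x $ k)\<^sup>2 \<le> (c - \<tau>)\<^sup>2" by (metis abs_ge_zero power2_abs power_mono)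
            show "(y p $ j - x $ j)\<^sup>2 \<le> \<rho>\<^sup>2" if "j \<in> UNIV - {k}" for j
            proof -
              have "\<bar>y p $ j - x $ j\<bar> \<le> \<rho>"
                using x[rule_format, of j] yj[of j p] rj[of j] that by (simp add: abs_minus_commute)
              then show ?thesis by (metis abs_ge_zero power2_abs power_mono)
            qed
          qed
          also have "\<dots> = (c - \<tau>)\<^sup>2 + (d - 1) * \<rho>\<^sup>2"
            using d unfolding d_def by (simp add: card_Diff_singleton of_nat_diff Suc_le_eq)
          also have "\<dots> = c\<^sup>2 - c * \<tau> - \<tau> * (c - \<tau>) + d * \<rho>\<^sup>2 - \<rho>\<^sup>2"
            by (simp add: power2_eq_square algebra_simps)
          also have "\<dots> \<le> c\<^sup>2"
          proof -
            have "\<tau> * (c - \<tau>) \<ge> 0" using \<tau> \<tau>le by simp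
            moreover have "\<rho>\<^sup>2 \<ge> 0" by simp
            ultimately show ?thesis unfolding c\<tau> by linarith
          qed
          finally show "(norm (y p - x))\<^sup>2 \<le> c\<^sup>2" .
        qed (use c in simp)
        show "c < norm (y p - x)"
          if q: "q \<in> layer_index k m" and x: "q \<noteq> p \<and> (\<forall>j. \<bar>x $ j - z q $ j\<bar> \<le> r $ j)" for q x
        proof (rule power2_less_imp_less)
          obtain j where j: "j \<noteq> k" "p j \<noteq> q j" using layer_index_differ[OF p q] x by metis
          have "c - 3 * \<tau> \<le> \<bar>y p $ k - x $ k\<bar>"
            using conjunct2[OF x, rule_format, of k] unfolding yk zk rk by linarith
          then have 1: "(c - 3 * \<tau>)\<^sup>2 \<le> (y p $ k - x $ k)\<^sup>2"
            using \<tau>le by (metis diff_ge_0_iff_ge power2_abs power_mono)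
          have "\<bar>x $ j - z q $ j\<bar> \<le> \<rho>"
            using conjunct2[OF x, rule_format, of j] rj[OF j(1)] by simp
          then have "1 / real m - \<rho> \<le> \<bar>y p $ j - x $ j\<bar>"
            using layer_centre_separated[where p = p and q = q and j = j and h = h, OF p j] yj[OF j(1), of p] unfolding z_def by linarith
          then have "5 * (d * \<rho>) \<le> \<bar>y p $ j - x $ j\<bar>" using \<rho>m d\<rho> by linarith
          then have 2: "(5 * (d * \<rho>))\<^sup>2 \<le> (y p $ j - x $ j)\<^sup>2"
            using d \<rho> by (metis abs_le_square_iff abs_of_nonneg mult_nonneg_nonneg
                order_trans zero_le_numeral less_imp_le zero_le_one)
          have "c\<^sup>2 < c\<^sup>2 - 6 * (d * \<rho>\<^sup>2) + 25 * (d * (d * \<rho>\<^sup>2))"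
          proof -
            have "d * \<rho>\<^sup>2 > 0" using d \<rho> by simp
            moreover have "1 * (d * \<rho>\<^sup>2) \<le> d * (d * \<rho>\<^sup>2)" using d calculation by (intro mult_right_mono) auto
            ultimately show ?thesis by linarith
          qed
          also have "\<dots> \<le> (c - 3 * \<tau>)\<^sup>2 + (5 * (d * \<rho>))\<^sup>2"
          proof -
            have "(c - 3 * \<tau>)\<^sup>2 + (5 * (d * \<rho>))\<^sup>2 = c\<^sup>2 - 6 * (c * \<tau>) + 9 * \<tau>\<^sup>2 + 25 * (d * (d * \<rho>\<^sup>2))"
              by (simp add: power2_eq_square algebra_simps)
            moreover have "\<tau>\<^sup>2 \<ge> 0" by simp
            ultimately show ?thesis unfolding c\<tau> by linarith
          qed
          also have "\<dots> \<le> (y p $ k - x $ k)\<^sup>2 + (y p $ j - x $ j)\<^sup>2"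
            using 1 2 by linarith
          also have "\<dots> \<le> (y p $ k - x $ k)\<^sup>2 + (\<Sum>j\<in>UNIV - {k}. (y p $ j - x $ j)\<^sup>2)"
            using j(1) member_le_sum[of j "UNIV - {k}" "\<lambda>j. (y p $ j - x $ j)\<^sup>2"] by simp
          also have "\<dots> = (norm (y p - x))\<^sup>2" by (subst norm_sq_remove[of _ k]) simp
          finally show "c\<^sup>2 < (norm (y p - x))\<^sup>2" .
        qed simp
      qed
      moreover have "C * (1 / real m) ^ (CARD('n) + 1) \<le> (\<Prod>j\<in>UNIV. 2 * r $ j)"
      proof -
        have "(\<Prod>j\<in>UNIV. 2 * r $ j) = 2 * \<tau> * (\<Prod>j\<in>UNIV - {k}. 2 * r $ j)"
          by (subst prod.remove[of _ k]) (auto simp: rk)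
        also have "(\<Prod>j\<in>UNIV - {k}. 2 * r $ j) = (\<Prod>j\<in>UNIV - {k}. 2 * \<rho>)"
          by (intro prod.cong) (auto simp: rj)
        also have "\<dots> = (2 * \<rho>) ^ (CARD('n) - 1)" by (simp add: card_Diff_singleton)
        also have "2 * \<rho> = 2 / (6 * d) * (1 / real m)" unfolding \<rho>_def by simp
        also have "2 * \<tau> = 2 * (1 / (36 * d * c)) * (1 / real m)\<^sup>2"
          unfolding \<tau>_def \<rho>_def using d c m by (simp add: power2_eq_square field_simps)
        also have "2 * (1 / (36 * d * c)) * (1 / real m)\<^sup>2 * (2 / (6 * d) * (1 / real m)) ^ (CARD('n) - 1)
           = C * (1 / real m) ^ (2 + (CARD('n) - 1))"
          unfolding C_def power_mult_distrib power_add by simp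
        also have "2 + (CARD('n) - 1) = CARD('n) + 1" using d unfolding d_def by simp
        finally show ?thesis by simp
      qed
      ultimately show ?case using \<rho> \<tau>
        by (intro exI[of _ z] exI[of _ r] exI[of _ y]) (auto simp: r_def)
    qed
  qed
  ultimately show ?thesis by blast
qed

lemma infnorm_le_iff: "infnorm (x :: real ^ 'n) \<le> a \<longleftrightarrow> (\<forall>j. \<bar>x $ j\<bar> \<le> a)"
proof
  show "\<forall>j. \<bar>x $ j\<bar> \<le> a" if "infnorm x \<le> a"
    using that component_le_infnorm_cart order_trans by blast
  show "infnorm x \<le> a" if "\<forall>j. \<bar>x $ j\<bar> \<le> a"
    unfolding infnorm_cart using that by (intro cSup_least) auto
qed

text \<open>
  The centres lie on a hyperplane perpendicular to \<open>(1, ..., 1)\<close> and the witness is near the corner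
  \<open>z p + c * (1, ..., 1)\<close> of the ball. Two points of the hyperplane differ by a vector of coordinate sum \<open>0\<close>, so some coordinate
  of the other centre is smaller, by at least \<open>\<beta> / m\<close> on the grid, and in this coordinate the other centre is too far from the
  witness. The grid has total extent at most \<open>d * \<beta> = (1 - c) / 2\<close> in each coordinate, so that it can be placed within
  \<open>[(1 - c) / 4, 3 * (1 - c) / 4]\<close> and the witnesses stay in the cube.
\<close>

lemma layer_config_linf:
  fixes c :: real and k :: "'n::finite"
  assumes c: "0 < c" "c < 1"
  shows "\<exists>C>0. \<forall>\<^sub>F m in sequentially. \<exists>z r y. layer_config (infnorm :: real ^ 'n \<Rightarrow> real) c k m z r y \<and>
       (\<forall>j. 0 \<le> r $ j) \<and> C * (1 / real m) ^ CARD('n) \<le> (\<Prod>j\<in>UNIV. 2 * r $ j)"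
proof -
  define d where "d = real CARD('n)"
  have d: "d \<ge> 1" unfolding d_def by (simp add: Suc_le_eq)
  define \<beta> where "\<beta> = (1 - c) / (2 * d)"
  have \<beta>: "\<beta> > 0" unfolding \<beta>_def using d c by simp
  have d\<beta>: "d * \<beta> = (1 - c) / 2" unfolding \<beta>_def using d by simp
  have \<beta>le: "\<beta> \<le> d * \<beta>" using d \<beta> by simp
  define C where "C = (2 * (\<beta> / 3)) ^ CARD('n)"
  have "C > 0" unfolding C_def using \<beta> by simp
  moreover have "\<forall>\<^sub>F m in sequentially. \<exists>z r y. layer_config (infnorm :: real ^ 'n \<Rightarrow> real) c k m z r y \<and>
       (\<forall>j. 0 \<le> r $ j) \<and> C * (1 / real m) ^ CARD('n) \<le> (\<Prod>j\<in>UNIV. 2 * r $ j)"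
  proof -
    (* Keeps the boxes inside the cube and the own centre within reach of the lowered witness. *)
    have "\<forall>\<^sub>F m in sequentially. 1 / real m \<le> min c ((1 - c) / 4) / \<beta>"
      using c \<beta> by (intro eventually_inverse_le) auto
    then show ?thesis using eventually_gt_at_top[of 0]
    proof eventually_elim
      case (elim m)
      have m: "real m > 0" using elim by simp
      define \<rho> where "\<rho> = \<beta> / (3 * real m)"
      have \<rho>: "\<rho> > 0" using m \<beta> unfolding \<rho>_def by simp
      have \<rho>m: "3 * \<rho> = \<beta> / real m" using m unfolding \<rho>_def by simp
      have \<rho>le: "\<rho> \<le> c" "\<rho> \<le> (1 - c) / 4"
      proof -
        have "\<beta> / real m \<le> min c ((1 - c) / 4)" using elim \<beta> m by (simp add: field_simps)
        then show "\<rho> \<le> c" "\<rho> \<le> (1 - c) / 4" using \<rho>m \<rho> by linarith+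
      qed
      define S where "S p = (\<Sum>j\<in>UNIV - {k}. real (p j))" for p :: "'n \<Rightarrow> nat"
      define z where "z p = (\<chi> j. if j = k then 3 * (1 - c) / 4 - \<beta> / real m * S p
          else (1 - c) / 4 + \<beta> / real m * real (p j))" for p
      define r where "r = (\<chi> j :: 'n. \<rho>)"
      define y where "y p = (\<chi> j. z p $ j + (c - \<rho>))" for p
      have zj: "(1 - c) / 4 \<le> z p $ j \<and> z p $ j \<le> 3 * (1 - c) / 4" if p: "p \<in> layer_index k m" for p j
      proof (cases "j = k")
        case True
        have "S p \<le> (\<Sum>j\<in>UNIV - {k}. real m)"
          unfolding S_def using layer_indexD(2)[OF p] by (intro sum_mono) (auto intro: less_imp_le)
        also have "\<dots> = (d - 1) * real m"
          using d unfolding d_def by (simp add: card_Diff_singleton of_nat_diff Suc_le_eq)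
        finally have "\<beta> / real m * S p \<le> \<beta> / real m * ((d - 1) * real m)"
          using \<beta> m by (intro mult_left_mono) auto
        also have "\<dots> = d * \<beta> - \<beta>" using m by (simp add: field_simps)
        finally have "\<beta> / real m * S p \<le> (1 - c) / 2" using d\<beta> \<beta> by linarith
        moreover have "0 \<le> S p" unfolding S_def by (simp add: sum_nonneg)
        then have "0 \<le> \<beta> / real m * S p" using \<beta> by simp
        moreover have "z p $ j = 3 * (1 - c) / 4 - \<beta> / real m * S p" using True unfolding z_def by simp
        ultimately show ?thesis by linarith
      next
        case False
        have "\<beta> / real m * real (p j) \<le> \<beta> / real m * real m"
          using layer_indexD(2)[OF p False] \<beta> by (intro mult_left_mono) auto
        also have "\<dots> = \<beta>" using m by simp
        finally have "\<beta> / real m * real (p j) \<le> (1 - c) / 2" using d\<beta> \<beta>le by linarith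
        moreover have "0 \<le> \<beta> / real m * real (p j)" using \<beta> by simp
        moreover have "z p $ j = (1 - c) / 4 + \<beta> / real m * real (p j)" using False unfolding z_def by simp
        ultimately show ?thesis by linarith
      qed
      have gap: "\<exists>j. z q $ j \<le> z p $ j - \<beta> / real m"
        if p: "p \<in> layer_index k m" and q: "q \<in> layer_index k m" and ne: "q \<noteq> p" for p q
      proof (cases "\<exists>j. j \<noteq> k \<and> q j < p j")
        case True
        then obtain j where j: "j \<noteq> k" "q j < p j" by blast
        have "\<beta> / real m * (real (q j) + 1) \<le> \<beta> / real m * real (p j)"
          using j \<beta> by (intro mult_left_mono) auto
        then have "\<beta> / real m * real (q j) + \<beta> / real m \<le> \<beta> / real m * real (p j)"
          by (simp only: distrib_left mult_1_right)
        moreover have "z p $ j = (1 - c) / 4 + \<beta> / real m * real (p j)" for p using j(1) unfolding z_def by simp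
        ultimately have "z q $ j \<le> z p $ j - \<beta> / real m" by simp
        then show ?thesis by blast
      next
        case False
        obtain i where i: "i \<noteq> k" "q i \<noteq> p i" using layer_index_differ[OF q p ne] by blast
        then have "q i > p i" using False by (metis linorder_neqE_nat)
        have "S p + 1 \<le> S q"
        proof -
          have "(\<Sum>j\<in>UNIV - {k}. real (p j)) = real (p i) + (\<Sum>j\<in>UNIV - {k} - {i}. real (p j))"
            "(\<Sum>j\<in>UNIV - {k}. real (q j)) = real (q i) + (\<Sum>j\<in>UNIV - {k} - {i}. real (q j))"
            using i(1) by (subst sum.remove[of _ i]; auto)+
          moreover have "(\<Sum>j\<in>UNIV - {k} - {i}. real (p j)) \<le> (\<Sum>j\<in>UNIV - {k} - {i}. real (q j))"
            using False by (intro sum_mono) (auto simp: not_less)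
          ultimately show ?thesis unfolding S_def using \<open>q i > p i\<close> by linarith
        qed
        then have "\<beta> / real m * (S p + 1) \<le> \<beta> / real m * S q" using \<beta> by (intro mult_left_mono) auto
        then have "\<beta> / real m * S p + \<beta> / real m \<le> \<beta> / real m * S q"
          by (simp only: distrib_left mult_1_right)
        moreover have "z p $ k = 3 * (1 - c) / 4 - \<beta> / real m * S p" for p unfolding z_def by simp
        ultimately have "z q $ k \<le> z p $ k - \<beta> / real m" by simp
        then show ?thesis by blast
      qed
      have "layer_config infnorm c k m z r y"
        unfolding layer_config_def
      proof (intro conjI ballI allI impI)
        fix p assume p: "p \<in> layer_index k m"
        show "0 \<le> z p $ j - r $ j" "z p $ j + r $ j \<le> 1" for j
          using zj[OF p, of j] \<rho>le c unfolding r_def by (simp_all add: field_simps)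
        have "0 \<le> y p $ j \<and> y p $ j \<le> 1" for j
          using zj[OF p, of j] \<rho>le \<rho> c unfolding y_def by (simp add: field_simps)
        then show "y p \<in> unit_cube" by (simp add: mem_box_cart)
        show "infnorm (y p - x) \<le> c" if x: "\<forall>j. \<bar>x $ j - z p $ j\<bar> \<le> r $ j" for x
          unfolding infnorm_le_iff
        proof
          fix j
          have "\<bar>x $ j - z p $ j\<bar> \<le> \<rho>" using x unfolding r_def by simp
          then have "\<bar>z p $ j + (c - \<rho>) - x $ j\<bar> \<le> c" using \<rho>le \<rho> by linarith
          then show "\<bar>(y p - x) $ j\<bar> \<le> c" unfolding y_def by simp
        qed
        show "c < infnorm (y p - x)"
          if q: "q \<in> layer_index k m" and x: "q \<noteq> p \<and> (\<forall>j. \<bar>x $ j - z q $ j\<bar> \<le> r $ j)" for q x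
        proof -
          obtain j where j: "z q $ j \<le> z p $ j - \<beta> / real m" using gap[OF p q] x by blast
          have "\<bar>x $ j - z q $ j\<bar> \<le> \<rho>" using x unfolding r_def by simp
          then have "c < \<bar>z p $ j + (c - \<rho>) - x $ j\<bar>" using j \<rho>m \<rho> by linarith
          then have "c < \<bar>(y p - x) $ j\<bar>" unfolding y_def by simp
          then show ?thesis using component_le_infnorm_cart[of "y p - x" j] by linarith
        qed
      qed
      moreover have "C * (1 / real m) ^ CARD('n) \<le> (\<Prod>j\<in>UNIV. 2 * r $ j)"
        unfolding r_def \<rho>_def C_def by (simp add: power_mult_distrib[symmetric])
      ultimately show ?case using \<rho>
        by (intro exI[of _ z] exI[of _ r] exI[of _ y]) (auto simp: r_def)
    qed
  qed
  ultimately show ?thesis by blast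
qed

lemma continuous_on_l1_norm: "continuous_on UNIV (l1_norm :: real ^ 'n \<Rightarrow> real)"
  unfolding l1_norm_def by (intro continuous_intros)

section \<open>The asymptotics of the cover number\<close>

theorem theorem2:
  fixes M :: "'a measure"
    and \<xi> :: "nat \<Rightarrow> 'a \<Rightarrow> real ^ 'n"
    and R :: "nat \<Rightarrow> 'a \<Rightarrow> real"
    and N :: "'a \<Rightarrow> nat"
    and rate c :: real
  assumes "CARD('n) \<ge> 2"
    and "poisson_balls M \<xi> R N rate"
    and "0 < c" and "c < 1"
    and "AE \<omega> in M. R 1 \<omega> = c"
  shows "nlogn_eq (cover_prob M l1_norm \<xi> R N) (1 + 1 / (real CARD('n) - 1))
    \<and> (nlogn_ge (cover_prob M norm \<xi> R N) (1 + 2 / (real CARD('n) - 1))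
       \<and> nlogn_le (cover_prob M norm \<xi> R N) (1 + 1 / (real CARD('n) - 1)))
    \<and> nlogn_ge (cover_prob M infnorm \<xi> R N) (1 + 1 / (real CARD('n) - 1))"
proof -
  interpret poisson_balls M \<xi> R N rate by fact
  define d where "d = real CARD('n)"
  have d: "d \<ge> 2" using assms(1) unfolding d_def by simp
  have d1: "d / (d - 1) = 1 + 1 / (d - 1)" "(d + 1) / (d - 1) = 1 + 2 / (d - 1)"
    using d by (simp_all add: field_simps)
  note c = assms(3,4)
  define B where "B = nat \<lceil>4 * d / c\<rceil>"
  have B: "4 * real CARD('n) / c \<le> real B" unfolding B_def d_def by linarith
  obtain k :: 'n where True by simp
  have le1: "nlogn_le (cover_prob M l1_norm \<xi> R N) (1 + 1 / (d - 1))"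
    unfolding d_def
    by (rule cover_prob_nlogn_le[OF assms(1,5) l1_norm_triangle l1_norm_le axis_descent_l1[OF c(1) B]]) auto
  have le2: "nlogn_le (cover_prob M norm \<xi> R N) (1 + 1 / (d - 1))"
    unfolding d_def
    by (rule cover_prob_nlogn_le[OF assms(1,5) norm_triangle_ineq norm_le_card axis_descent_l2[OF c(1) B]]) auto
  have "nlogn_ge (cover_prob M l1_norm \<xi> R N) (real CARD('n) / (real CARD('n) - 1))"
    by (rule cover_prob_nlogn_ge[OF assms(1,5) continuous_on_l1_norm _ _ layer_config_l1[OF c, of k]]) auto
  then have ge1: "nlogn_ge (cover_prob M l1_norm \<xi> R N) (1 + 1 / (d - 1))"
    using d1 unfolding d_def by simp
  obtain C2 where C2: "C2 > 0" "\<forall>\<^sub>F m in sequentially. \<exists>z r y. layer_config (norm :: real ^ 'n \<Rightarrow> real) c k m z r y \<and>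
       (\<forall>j. 0 \<le> r $ j) \<and> C2 * (1 / real m) ^ (CARD('n) + 1) \<le> (\<Prod>j\<in>UNIV. 2 * r $ j)"
    using layer_config_l2[OF c, of k] by blast
  have "nlogn_ge (cover_prob M norm \<xi> R N) (real (CARD('n) + 1) / (real CARD('n) - 1))"
    by (rule cover_prob_nlogn_ge[OF assms(1,5) continuous_on_norm_id _ C2]) auto
  then have ge2: "nlogn_ge (cover_prob M norm \<xi> R N) (1 + 2 / (d - 1))"
    using d1 unfolding d_def by (simp add: add.commute)
  obtain C3 where C3: "C3 > 0" "\<forall>\<^sub>F m in sequentially. \<exists>z r y. layer_config (infnorm :: real ^ 'n \<Rightarrow> real) c k m z r y \<and>
       (\<forall>j. 0 \<le> r $ j) \<and> C3 * (1 / real m) ^ CARD('n) \<le> (\<Prod>j\<in>UNIV. 2 * r $ j)"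
    using layer_config_linf[OF c, of k] by blast
  have "nlogn_ge (cover_prob M infnorm \<xi> R N) (real CARD('n) / (real CARD('n) - 1))"
    by (rule cover_prob_nlogn_ge[OF assms(1,5) continuous_on_infnorm[OF continuous_on_id] _ C3]) auto
  then have ge3: "nlogn_ge (cover_prob M infnorm \<xi> R N) (1 + 1 / (d - 1))"
    using d1 unfolding d_def by simp
  have "nlogn_eq (cover_prob M l1_norm \<xi> R N) (1 + 1 / (d - 1))"
    using d by (intro nlogn_eqI le1 ge1) (simp add: add_pos_pos)
  then show ?thesis using le2 ge2 ge3 unfolding d_def by blast
qed

end
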